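(* Let $X$ be a smooth manifold with no boundary and let $c:X\to\mathbb{R}$ be a non-proper and non-constant smooth function, with Reeb space $R_c$, quotient map $q_c:X\to R_c$ and induced function $\bar c:R_c\to\mathbb{R}$, $c=\bar c\circ q_c$. Let $\{U_{\lambda_{\rm P}}\}_{\lambda_{\rm P}\in\Lambda_{\rm P}}$ be a family of non-empty open subsets of $R_c$ and let $\{U_{\lambda_{\rm NP}}\}_{\lambda_{\rm NP}\in\Lambda_{\rm NP}}$ be a family of non-empty open and connected subsets of $R_c$ such that: (i) all the sets $U_{\lambda_{\rm P}}$ ($\lambda_{\rm P}\in\Lambda_{\rm P}$) and $U_{\lambda_{\rm NP}}$ ($\lambda_{\rm NP}\in\Lambda_{\rm NP}$) are mutually disjoint; (ii) for every $\lambda_{\rm P}\in\Lambda_{\rm P}$ the restriction $c|_{q_c^{-1}(U_{\lambda_{\rm P}})}$ is proper; (iii) for every $\lambda_{\rm NP}\in\Lambda_{\rm NP}$ the restriction $c|_{q_c^{-1}(U_{\lambda_{\rm NP}})}$ has no critical point, and its level sets are always non-compact and connected. Define the closed subset $$V:=R_c-\Big(\bigsqcup_{\lambda_{\rm P}\in\Lambda_{\rm P}}U_{\lambda_{\rm P}}\ \sqcup\ \bigsqcup_{\lambda_{\rm NP}\in\Lambda_{\rm NP}}U_{\lambda_{\rm NP}}\Big)\subset R_c .$$ Then the following two hold. (1) $R_c$ is Hausdorff if and only if for each $v\in\bar c(V)$, any two distinct points of $\bar c^{-1}(v)\subset R_c$ can be separated by suitable (disjoint) open neighborhoods in $R_c$.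 (2) Suppose that $R_c$ is Hausdorff and that for every $\lambda_{\rm P}\in\Lambda_{\rm P}$ the closure $\overline{U_{\lambda_{\rm P}}}^{R_c}$ of $U_{\lambda_{\rm P}}$ in $R_c$ is compact. Then there is a $1$-dimensional CW complex whose underlying space is $R_c$, the set of all $0$-cells of which is the closed and discrete subset $\bar c^{-1}(\bar c(V))\cup q_c(S(c))$ of $R_c$, and which may not be locally finite, if and only if both of the following hold: (a) $\bar c^{-1}(\bar c(V))$ is closed and discrete in $R_c$; (b) for every $\lambda_{\rm P}\in\Lambda_{\rm P}$ the set $c\big(S(c|_{q_c^{-1}(U_{\lambda_{\rm P}})})\big)$ is finite.
   Context: For a continuous function $c:X\to\mathbb{R}$ on a topological space $X$, a level set of $c$ is a preimage $c^{-1}(y)$, $y \in \mathbb{R}$. Define an equivalence relation $\sim_c$ on $X$ by $x_1\sim_c x_2$ if and only if $x_1$ and $x_2$ belong to the same connected component of a level set $c^{-1}(y)$. The Reeb space of $c$ is the quotient space $R_c:=X/{\sim_c}$ with the quotient topology; $q_c:X\to R_c$ is the quotient map, and $\bar c:R_c\to\mathbb{R}$ is the unique continuous function with $c=\bar c\circ q_c$. A real-valued function $c:X\to\mathbb{R}$ is proper if $c^{-1}(K)$ is compact for every compact $K\subset\mathbb{R}$, and non-proper if it is not proper. For a differentiable function $c$ on a manifold, a critical point is a point where the differential of $c$ vanishes; $S(c)$ is the set of all critical points of $c$ (the critical set), and $c(S(c))$ is the critical value set. For a subset $Z$ of the domain, $c|_Z$ is the restriction of $c$ to $Z$; for $Y\subset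 X$ with $X$ a topological space, $\overline{Y}^X$ is the closure of $Y$ in $X$. Convention on CW complexes: $1$-dimensional CW complexes here are Hausdorff and are allowed to have $1$-cells (homeomorphic to open intervals) whose closures are not compact, and are allowed not to be locally finite. A CW complex "whose underlying space is $R_c$" means the Reeb space $R_c$ endowed with the structure of such a cell complex.
   Formalization: In (2) the weak topology of the CW complex is replaced by closedness of every union of closed cells, since at 0-cells meeting infinitely many 1-cells the weak topology can fail and make the "if" part false; complexes of dimension 0 are also allowed. *)

theory Defs
  imports "HOL-Analysis.Analysis"
begin

section \<open>Smooth manifolds without boundary and critical points\<close>

text \<open>
  The model space of dimension \<open>n\<close> (also \<open>n = 0\<close>) is \<^const>\<open>Euclidean_space\<close>, whose points are
  the sequences \<open>nat \<Rightarrow> real\<close> vanishing from index \<open>n\<close> on.  Functions on open subsets of it are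
  smooth if all iterated partial derivatives exist and are continuous.
\<close>

definition partial_deriv :: "nat \<Rightarrow> ((nat \<Rightarrow> real) \<Rightarrow> real) \<Rightarrow> (nat \<Rightarrow> real) \<Rightarrow> real" where
  "partial_deriv i f x = deriv (\<lambda>t. f (x(i := t))) (x i)"

fun Ck_on :: "nat \<Rightarrow> nat \<Rightarrow> (nat \<Rightarrow> real) set \<Rightarrow> ((nat \<Rightarrow> real) \<Rightarrow> real) \<Rightarrow> bool" where
  "Ck_on n 0 U f \<longleftrightarrow> continuous_map (subtopology (Euclidean_space n) U) euclideanreal f"
| "Ck_on n (Suc k) U f \<longleftrightarrow>
     continuous_map (subtopology (Euclidean_space n) U) euclideanreal f \<and>
     (\<forall>i<n. (\<forall>x\<in>U. (\<lambda>t. f (x(i := t))) differentiable at (x i)) \<and>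
            Ck_on n k U (partial_deriv i f))"

definition smooth_fun_on :: "nat \<Rightarrow> (nat \<Rightarrow> real) set \<Rightarrow> ((nat \<Rightarrow> real) \<Rightarrow> real) \<Rightarrow> bool" where
  "smooth_fun_on n U f \<longleftrightarrow> (\<forall>k. Ck_on n k U f)"

type_synonym 'a chart = "'a set \<times> ('a \<Rightarrow> nat \<Rightarrow> real)"

text \<open>
  The smooth structure is given by an arbitrary (not necessarily maximal) smooth atlas.
\<close>

definition smooth_manifold :: "nat \<Rightarrow> 'a topology \<Rightarrow> 'a chart set \<Rightarrow> bool" where
  "smooth_manifold n X \<A> \<longleftrightarrow>
     Hausdorff_space X \<and> second_countable X \<and>
     (\<Union>(U, \<phi>)\<in>\<A>. U) = topspace X \<and>
     (\<forall>(U, \<phi>)\<in>\<A>. openin X U \<and> openin (Euclidean_space n) (\<phi> ` U) \<and>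
        homeomorphic_map (subtopology X U) (subtopology (Euclidean_space n) (\<phi> ` U)) \<phi>) \<and>
     (\<forall>(U, \<phi>)\<in>\<A>. \<forall>(U', \<psi>)\<in>\<A>. \<forall>j<n.
        smooth_fun_on n (\<phi> ` (U \<inter> U')) (\<lambda>y. \<psi> (inv_into U \<phi> y) j))"

definition smooth_function :: "nat \<Rightarrow> 'a chart set \<Rightarrow> ('a \<Rightarrow> real) \<Rightarrow> bool" where
  "smooth_function n \<A> c \<longleftrightarrow>
     (\<forall>(U, \<phi>)\<in>\<A>. smooth_fun_on n (\<phi> ` U) (c \<circ> inv_into U \<phi>))"

text \<open>
  The differential of \<open>c\<close> at \<open>p\<close> is, in the coordinates of a chart \<open>\<phi>\<close>, the linear form whose
  coefficients are the partial derivatives of \<open>c \<circ> \<phi>\<^sup>-\<^sup>1\<close> at \<open>\<phi> p\<close>.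
\<close>

definition critical_set :: "nat \<Rightarrow> 'a chart set \<Rightarrow> ('a \<Rightarrow> real) \<Rightarrow> 'a set" where
  "critical_set n \<A> c =
     {p \<in> (\<Union>(U, \<phi>)\<in>\<A>. U).
        \<forall>(U, \<phi>)\<in>\<A>. p \<in> U \<longrightarrow> (\<forall>i<n. partial_deriv i (c \<circ> inv_into U \<phi>) (\<phi> p) = 0)}"

text \<open>The atlas of the open submanifold \<open>Z\<close>.\<close>

definition restrict_atlas :: "'a chart set \<Rightarrow> 'a set \<Rightarrow> 'a chart set" where
  "restrict_atlas \<A> Z = (\<lambda>(U, \<phi>). (U \<inter> Z, \<phi>)) ` \<A>"


section \<open>Level sets, proper functions, Reeb spaces\<close>

definition level_set :: "'a topology \<Rightarrow> ('a \<Rightarrow> real) \<Rightarrow> real \<Rightarrow> 'a set" where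
  "level_set X c y = {x \<in> topspace X. c x = y}"

definition proper_fun :: "'a topology \<Rightarrow> ('a \<Rightarrow> real) \<Rightarrow> bool" where
  "proper_fun X c \<longleftrightarrow> (\<forall>K. compact K \<longrightarrow> compactin X {x \<in> topspace X. c x \<in> K})"

definition Reeb_rel :: "'a topology \<Rightarrow> ('a \<Rightarrow> real) \<Rightarrow> ('a \<times> 'a) set" where
  "Reeb_rel X c =
     {(x1, x2). \<exists>y. connected_component_of (subtopology X (level_set X c y)) x1 x2}"

definition Reeb_proj :: "'a topology \<Rightarrow> ('a \<Rightarrow> real) \<Rightarrow> 'a \<Rightarrow> 'a set" where
  "Reeb_proj X c x = Reeb_rel X c `` {x}"

definition Reeb_space :: "'a topology \<Rightarrow> ('a \<Rightarrow> real) \<Rightarrow> 'a set topology" where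
  "Reeb_space X c = topology (\<lambda>W. W \<subseteq> topspace X // Reeb_rel X c \<and>
                                  openin X {x \<in> topspace X. Reeb_proj X c x \<in> W})"

definition Reeb_fun :: "('a \<Rightarrow> real) \<Rightarrow> 'a set \<Rightarrow> real" where
  "Reeb_fun c r = the_elem (c ` r)"

lemma equiv_Reeb_rel: "equiv (topspace X) (Reeb_rel X c)"
proof (rule equivI)
  show "Reeb_rel X c \<subseteq> topspace X \<times> topspace X"
    by (auto simp: Reeb_rel_def connected_component_of_equiv)
  show "refl_on (topspace X) (Reeb_rel X c)"
    by (auto simp: refl_on_def Reeb_rel_def connected_component_of_refl level_set_def)
  show "sym (Reeb_rel X c)"
    by (auto simp: sym_def Reeb_rel_def connected_component_of_sym)
  show "trans (Reeb_rel X c)"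
  proof (rule transI)
    fix x y z assume "(x, y) \<in> Reeb_rel X c" "(y, z) \<in> Reeb_rel X c"
    then obtain s t
      where s: "connected_component_of (subtopology X (level_set X c s)) x y"
        and t: "connected_component_of (subtopology X (level_set X c t)) y z"
      by (auto simp: Reeb_rel_def)
    from s have "y \<in> level_set X c s"
      by (simp add: connected_component_of_equiv)
    moreover from t have "y \<in> level_set X c t"
      by (simp add: connected_component_of_equiv)
    ultimately have "s = t" by (simp add: level_set_def)
    with s t have "connected_component_of (subtopology X (level_set X c s)) x z"
      using connected_component_of_trans by metis
    then show "(x, z) \<in> Reeb_rel X c"
      by (auto simp: Reeb_rel_def)
  qed
qed

lemma openin_Reeb_space:
  "openin (Reeb_space X c) W \<longleftrightarrow>
     W \<subseteq> topspace X // Reeb_rel X c \<and> openin X {x \<in> topspace X. Reeb_proj X c x \<in> W}"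
proof -
  have "istopology (\<lambda>W. W \<subseteq> topspace X // Reeb_rel X c \<and>
                        openin X {x \<in> topspace X. Reeb_proj X c x \<in> W})"
    unfolding istopology_def
  proof (intro conjI allI impI)
    fix S T
    assume S: "S \<subseteq> topspace X // Reeb_rel X c \<and> openin X {x \<in> topspace X. Reeb_proj X c x \<in> S}"
      and T: "T \<subseteq> topspace X // Reeb_rel X c \<and> openin X {x \<in> topspace X. Reeb_proj X c x \<in> T}"
    show "S \<inter> T \<subseteq> topspace X // Reeb_rel X c" using S by blast
    have "{x \<in> topspace X. Reeb_proj X c x \<in> S \<inter> T} =
          {x \<in> topspace X. Reeb_proj X c x \<in> S} \<inter> {x \<in> topspace X. Reeb_proj X c x \<in> T}"
      by blast
    then show "openin X {x \<in> topspace X. Reeb_proj X c x \<in> S \<inter> T}"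
      using S T by (simp add: openin_Int)
  next
    fix \<K>
    assume K: "\<forall>S\<in>\<K>. S \<subseteq> topspace X // Reeb_rel X c \<and>
                  openin X {x \<in> topspace X. Reeb_proj X c x \<in> S}"
    then show "\<Union>\<K> \<subseteq> topspace X // Reeb_rel X c" by blast
    have "{x \<in> topspace X. Reeb_proj X c x \<in> \<Union>\<K>} =
          (\<Union>S\<in>\<K>. {x \<in> topspace X. Reeb_proj X c x \<in> S})"
      by blast
    then show "openin X {x \<in> topspace X. Reeb_proj X c x \<in> \<Union>\<K>}"
      using K by auto
  qed
  then show ?thesis
    by (simp add: Reeb_space_def topology_inverse')
qed

lemma topspace_Reeb_space: "topspace (Reeb_space X c) = topspace X // Reeb_rel X c"
proof
  show "topspace (Reeb_space X c) \<subseteq> topspace X // Reeb_rel X c"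
    using openin_Reeb_space openin_topspace by blast
  have "{x \<in> topspace X. Reeb_proj X c x \<in> topspace X // Reeb_rel X c} = topspace X"
    by (auto simp: Reeb_proj_def quotientI)
  then have "openin (Reeb_space X c) (topspace X // Reeb_rel X c)"
    by (simp add: openin_Reeb_space)
  then show "topspace X // Reeb_rel X c \<subseteq> topspace (Reeb_space X c)"
    by (rule openin_subset)
qed

lemma quotient_map_Reeb_proj: "quotient_map X (Reeb_space X c) (Reeb_proj X c)"
proof -
  have "Reeb_proj X c ` topspace X = topspace X // Reeb_rel X c"
    unfolding Reeb_proj_def quotient_def by blast
  then show ?thesis
    unfolding quotient_map_def topspace_Reeb_space openin_Reeb_space by simp
qed

lemma Reeb_fun_proj:
  assumes "x \<in> topspace X"
  shows "Reeb_fun c (Reeb_proj X c x) = c x"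
proof -
  have "c x' = c x" if "(x, x') \<in> Reeb_rel X c" for x'
  proof -
    from that obtain y where "connected_component_of (subtopology X (level_set X c y)) x x'"
      by (auto simp: Reeb_rel_def)
    then have "x \<in> level_set X c y" "x' \<in> level_set X c y"
      by (simp_all add: connected_component_of_equiv)
    then show ?thesis by (simp add: level_set_def)
  qed
  moreover have "(x, x) \<in> Reeb_rel X c"
    using equiv_Reeb_rel[of X c] assms by (auto simp: equiv_def refl_on_def)
  ultimately have "c ` Reeb_proj X c x = {c x}"
    unfolding Reeb_proj_def by blast
  then show ?thesis by (simp add: Reeb_fun_def)
qed

lemma continuous_map_Reeb_fun:
  assumes "continuous_map X euclideanreal c"
  shows "continuous_map (Reeb_space X c) euclideanreal (Reeb_fun c)"
proof -
  have "continuous_map X euclideanreal (Reeb_fun c \<circ> Reeb_proj X c)"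
    using assms by (rule continuous_map_eq) (simp add: Reeb_fun_proj)
  then show ?thesis
    by (rule continuous_compose_quotient_map[OF quotient_map_Reeb_proj])
qed


section \<open>One-dimensional cell complexes\<close>

definition closed_discrete_in :: "'a topology \<Rightarrow> 'a set \<Rightarrow> bool" where
  "closed_discrete_in R S \<longleftrightarrow> closedin R S \<and> subtopology R S = discrete_topology S"

text \<open>
  A 1-cell is homeomorphic to an open interval, and its closure need not be compact.  Accordingly
  the characteristic map is defined on an interval \<open>J\<close> between \<open>(0,1)\<close> and \<open>[0,1]\<close>: an end of the
  1-cell either is attached to a 0-cell or has no limit point.  For \<open>J = [0,1]\<close> in a Hausdorff
  space this is the usual characteristic map of a 1-cell.
\<close>

definition one_cell :: "'a topology \<Rightarrow> 'a set \<Rightarrow> 'a set \<Rightarrow> bool" where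
  "one_cell R Z e \<longleftrightarrow>
     (\<exists>J h. {0<..<1::real} \<subseteq> J \<and> J \<subseteq> {0..1} \<and>
            quotient_map (top_of_set J) (subtopology R (R closure_of e)) h \<and>
            homeomorphic_map (top_of_set {0<..<1}) (subtopology R e) h \<and>
            h ` (J - {0<..<1}) \<subseteq> Z)"

text \<open>
  \<open>CW_complex_1 R Z \<E>\<close>: the space \<open>R\<close> is endowed with the structure of a cell complex with set of
  0-cells \<open>Z\<close> and set of 1-cells \<open>\<E>\<close>.  The dimension is at most 1, so \<open>\<E>\<close> may be empty.

  The last two conditions say that every union of closed cells (every subcomplex) is closed in \<open>R\<close>.
  Where the complex is locally finite, this amounts to the weak topology.  At a 0-cell meeting
  infinitely many 1-cells the weak topology is not demanded, because the quotient topology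
  of a Reeb space can be strictly coarser.  For example, take
  \<open>c (x, y) = g x * f y\<close> on the plane, where \<open>g x = exp (- 1 / x)\<close> for \<open>x > 0\<close> and \<open>g x = 0\<close>
  otherwise, and where \<open>f \<ge> 0\<close> is smooth, has exactly one local maximum \<open>m n\<close> and no zero in
  each interval \<open>(1/(n+1), 1/n)\<close>, \<open>n \<ge> 1\<close>, and vanishes elsewhere.  Its Reeb space consists of the
  intervals \<open>[0, m n)\<close> with their endpoints \<open>0\<close> identified; the set consisting of the points
  \<open>m n / (n + 1)\<close>, one in each of these intervals, meets every closed cell in one point at most,
  but has the vertex in its closure.
\<close>

definition CW_complex_1 :: "'a topology \<Rightarrow> 'a set \<Rightarrow> 'a set set \<Rightarrow> bool" where
  "CW_complex_1 R Z \<E> \<longleftrightarrow>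
     Hausdorff_space R \<and>
     topspace R = Z \<union> \<Union>\<E> \<and> Z \<inter> \<Union>\<E> = {} \<and> disjoint \<E> \<and>
     (\<forall>e\<in>\<E>. one_cell R Z e) \<and>
     closed_discrete_in R Z \<and>
     (\<forall>\<E>'\<subseteq>\<E>. closedin R (\<Union>e\<in>\<E>'. R closure_of e))"

end

theory Submission
  imports Defs
begin

text \<open>
  The Reeb space \<open>R\<close> is locally connected, being a quotient of a manifold, and away from the points
  that contain critical points of \<open>c\<close>, the induced function \<open>cbar\<close> is a local coordinate on each of
  the given pieces.

  Local picture.  At a noncritical point, \<open>c\<close> is strictly monotone in one coordinate, so small boxes
  meet every level set in a connected graph (\<open>increasing_level_box\<close>).  In a piece on
  which \<open>c\<close> is proper, a component of a level set without critical points is covered by finitely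
  many such boxes, and it follows that \<open>cbar\<close> is injective and open near the corresponding point of
  \<open>R\<close> (\<open>regular_at_Reeb_proper\<close>).  On a piece \<open>UNP\<close> the level sets are connected, so \<open>cbar\<close> is
  injective on the whole piece, and it is open as there are no critical points.

  Hausdorff property.  Points with different values are separated by \<open>cbar\<close>, and points in different
  pieces by the pieces.  Two points of a proper piece with the same value are components of a compact
  level set, which are separated by saturated open sets (\<open>Reeb_proper_fibre_separation\<close>), and two
  points of a piece \<open>UNP\<close> never have the same value.  Only the fibres over \<open>cbar ` V\<close> remain.

  Cell structure.  If a Hausdorff, locally connected space carries a continuous real function that
  is injective and open near each point off a closed discrete set \<open>Z\<close>, then the components of the complement
  of \<open>Z\<close> are arcs on which the function is monotone, each end of an arc either converges to a
  point of \<open>Z\<close> or has no limit point, and unions of closed arcs are closed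
  (\<open>regular_off_discrete_imp_CW\<close>).  It remains to see when \<open>Z = W \<union> q ` critical_set n \<A> c\<close> is closed and discrete.
  A proper piece is both open and closed in \<open>R\<close>, because properness refers to the whole real line;
  so under the assumption on closures it is compact.  A closed discrete set \<open>Z\<close> meets it in a
  finite set, which gives the finiteness of critical values.  Conversely, if
  a compact proper piece has finitely many critical values, then each of its level sets
  has finitely many components (\<open>finite_fibre\<close>), so \<open>Z\<close> meets the piece in a finite set if \<open>W\<close> is
  closed and discrete.  No
  accumulation of such sets is possible at a point of \<open>V\<close>: a connected neighbourhood of it
  cannot meet an open and closed set not containing it.
\<close>

section \<open>Real-valued functions that are local charts\<close>

text \<open>
  A continuous \<open>f\<close> maps such a set homeomorphically onto an open set of reals.
\<close>

definition real_chart :: "'a topology \<Rightarrow> ('a \<Rightarrow> real) \<Rightarrow> 'a set \<Rightarrow> bool" where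
  "real_chart R f A \<longleftrightarrow> openin R A \<and> inj_on f A \<and> (\<forall>B. openin R B \<and> B \<subseteq> A \<longrightarrow> open (f ` B))"

definition regular_at :: "'a topology \<Rightarrow> ('a \<Rightarrow> real) \<Rightarrow> 'a \<Rightarrow> bool" where
  "regular_at R f x \<longleftrightarrow> (\<exists>A. x \<in> A \<and> real_chart R f A)"

lemma real_chart_subset: "real_chart R f A \<Longrightarrow> openin R B \<Longrightarrow> B \<subseteq> A \<Longrightarrow> real_chart R f B"
  unfolding real_chart_def by (meson inj_on_subset subset_trans)

lemma real_chart_compose:
  assumes A: "real_chart R f A" and "inj g" and g: "\<And>S. open S \<Longrightarrow> open (g ` S)"
  shows "real_chart R (g \<circ> f) A"
proof -
  have "inj_on (g \<circ> f) A"
    using A \<open>inj g\<close> by (auto simp: real_chart_def inj_on_def)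
  moreover have "open ((g \<circ> f) ` B)" if "openin R B" "B \<subseteq> A" for B
    using g[of "f ` B"] A that by (simp only: image_comp[symmetric]) (simp add: real_chart_def)
  ultimately show ?thesis using A by (simp add: real_chart_def)
qed

lemma real_chart_uminus: "real_chart R f A \<Longrightarrow> real_chart R (\<lambda>x. - f x) A"
  using real_chart_compose[of R f A uminus] by (simp add: o_def open_negations)

lemma arctan_open_image: "open S \<Longrightarrow> open (arctan ` S)"
proof -
  assume S: "open S"
  have "arctan ` S = {y \<in> {- (pi/2)<..<pi/2}. tan y \<in> S}"
    using arctan_lbound arctan_ubound tan_arctan arctan_tan by (force simp: image_iff)
  moreover have "continuous_on {- (pi/2)<..<pi/2} tan"
    by (intro continuous_at_imp_continuous_on ballI isCont_tan)
       (use cos_gt_zero_pi in \<open>auto simp: less_le\<close>)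
  ultimately show ?thesis
    using continuous_open_preimage[of "{- (pi/2)<..<pi/2}" tan S] S
    by (simp add: vimage_def Int_def)
qed

lemma real_chart_arctan: "real_chart R f A \<Longrightarrow> real_chart R (arctan \<circ> f) A"
  by (rule real_chart_compose) (auto simp: arctan_open_image inj_def arctan_eq_iff)

lemma closure_of_meets_open:
  assumes "x \<in> R closure_of e" "openin R U" "x \<in> U"
  obtains y where "y \<in> e" "y \<in> U"
  using assms unfolding in_closure_of by metis

lemma Hausdorff_spaceE:
  assumes "Hausdorff_space R" "x \<in> topspace R" "y \<in> topspace R" "x \<noteq> y"
  obtains P Q where "openin R P" "openin R Q" "x \<in> P" "y \<in> Q" "disjnt P Q"
  using assms unfolding Hausdorff_space_def by metis

lemma locally_connected_spaceE:
  assumes "locally_connected_space R" "openin R G" "x \<in> G"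
  obtains U where "openin R U" "connectedin R U" "x \<in> U" "U \<subseteq> G"
  using assms unfolding locally_connected_space by metis

text \<open>
  Over the interval \<open>f ` S \<inter> f ` T\<close> both charts have a continuous inverse.  The parameters at which
  the two inverses agree form an open set because \<open>S \<inter> T\<close> is open, and those at which they differ
  form an open set because the space is Hausdorff.  The interval is connected and the inverses agree
  somewhere, so they agree everywhere.  In the line with two origins, which is not Hausdorff, this
  uniqueness of lifts fails.
\<close>

lemma real_chart_union:
  assumes H: "Hausdorff_space R" and f: "continuous_map R euclideanreal f"
    and S: "real_chart R f S" "connectedin R S" and T: "real_chart R f T" "connectedin R T"
    and ne: "S \<inter> T \<noteq> {}"
  shows "real_chart R f (S \<union> T)"
proof -
  have oS: "openin R S" and oT: "openin R T" and iS: "inj_on f S" and iT: "inj_on f T"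
    using S T by (auto simp: real_chart_def)
  define I where "I = f ` S \<inter> f ` T"
  define A where "A = f ` (S \<inter> T)"
  have opn: "open (f ` B)" if "openin R B" "B \<subseteq> S \<or> B \<subseteq> T" for B
    using S(1) T(1) that by (auto simp: real_chart_def)
  have "connected (f ` S)" "connected (f ` T)"
    using connectedin_continuous_map_image[OF f] S(2) T(2) by auto
  then have cI: "connected I"
    unfolding I_def by (metis is_interval_connected_1 is_interval_Int)
  have oA: "open A"
    unfolding A_def using oS oT by (intro opn) auto
  have oI: "\<exists>U. open U \<and> t \<in> U \<and> U \<inter> A = {}" if t: "t \<in> I - A" for t
  proof -
    from t obtain x y where x: "x \<in> S" "f x = t" and y: "y \<in> T" "f y = t"
      unfolding I_def by auto
    have "x \<noteq> y" using t x y unfolding A_def by auto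
    then obtain P Q where PQ: "openin R P" "openin R Q" "x \<in> P" "y \<in> Q" "disjnt P Q"
      using Hausdorff_spaceE[OF H, of x y] x y openin_subset[OF oS] openin_subset[OF oT] by blast
    define U where "U = f ` (P \<inter> S) \<inter> f ` (Q \<inter> T)"
    have "open U" unfolding U_def using PQ oS oT by (intro open_Int opn) auto
    moreover have "t \<in> U" unfolding U_def using x y PQ by (metis IntI image_eqI)
    moreover have "u \<notin> A" if u: "u \<in> U" for u
    proof
      assume "u \<in> A"
      then obtain z where z: "z \<in> S" "z \<in> T" "f z = u" unfolding A_def by auto
      from u obtain p q where "p \<in> P" "p \<in> S" "f p = u" "q \<in> Q" "q \<in> T" "f q = u"
        unfolding U_def by auto
      with z iS iT have "p = z" "q = z" by (auto simp: inj_on_def)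
      with \<open>p \<in> P\<close> \<open>q \<in> Q\<close> PQ show False by (auto simp: disjnt_iff)
    qed
    ultimately show ?thesis by auto
  qed
  have "I \<subseteq> A"
  proof (rule ccontr)
    assume "\<not> I \<subseteq> A"
    then obtain t where t: "t \<in> I - A" by auto
    define U where "U = \<Union>{U. open U \<and> U \<inter> A = {}}"
    have "open U" "U \<inter> A = {}" unfolding U_def by auto
    moreover have "I - A \<subseteq> U" unfolding U_def using oI by blast
    moreover have "A \<inter> I \<noteq> {}" using ne unfolding A_def I_def by auto
    ultimately show False
      using cI oA t unfolding connected_def by blast
  qed
  then have AI: "I = A" unfolding A_def I_def by auto
  have "inj_on f (S \<union> T)"
  proof -
    have "x = y" if x: "x \<in> S" and y: "y \<in> T" and e: "f x = f y" for x y
    proof -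
      have "f x \<in> I" unfolding I_def using x y e by (metis IntI image_eqI)
      then have "f x \<in> A" using AI by simp
      then obtain z where "z \<in> S" "z \<in> T" "f z = f x" unfolding A_def by auto
      with x y e iS iT have "z = x" "z = y" by (auto simp: inj_on_def)
      then show ?thesis by simp
    qed
    then show ?thesis
      using iS iT by (intro inj_onI) (metis Un_iff inj_onD)
  qed
  moreover have "open (f ` B)" if B: "openin R B" "B \<subseteq> S \<union> T" for B
  proof -
    have "f ` B = f ` (B \<inter> S) \<union> f ` (B \<inter> T)" using B by auto
    moreover have "open (f ` (B \<inter> S))" "open (f ` (B \<inter> T))" using oS oT B by (auto intro!: opn)
    ultimately show ?thesis by (metis open_Un)
  qed
  ultimately show ?thesis
    using oS oT by (auto simp: real_chart_def)
qed

lemma regular_at_connected_chart: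
  assumes "locally_connected_space R" and "regular_at R f x" and "openin R G" "x \<in> G"
  obtains S where "real_chart R f S" "connectedin R S" "x \<in> S" "S \<subseteq> G"
proof -
  obtain A where A: "x \<in> A" "real_chart R f A" using assms(2) by (auto simp: regular_at_def)
  then have "openin R (A \<inter> G)" using assms by (auto simp: real_chart_def)
  then obtain S where "openin R S" "connectedin R S" "x \<in> S" "S \<subseteq> A \<inter> G"
    using assms(1,4) A(1) unfolding locally_connected_space by (metis IntI)
  then show ?thesis using A real_chart_subset that by (metis Int_subset_iff)
qed

text \<open>
  The union of all connected charts through one point is a chart by uniqueness of lifts.  It is
  closed in the component because a connected chart that meets it can be adjoined to it.  So a
  component consisting of regular points is an open arc on which the function is monotone, and
  never a circle.
\<close>

lemma component_real_chart:
  assumes H: "Hausdorff_space R" and lc: "locally_connected_space R"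
    and f: "continuous_map R euclideanreal f"
    and G: "openin R G" and reg: "\<And>x. x \<in> G \<Longrightarrow> regular_at R f x"
    and e: "e \<in> connected_components_of (subtopology R G)"
  shows "real_chart R f e" "connectedin R e"
proof -
  have "locally_connected_space (subtopology R G)"
    using lc G by (rule locally_connected_space_open_subset)
  then have "openin (subtopology R G) e"
    using e by (rule openin_connected_components_of_locally_connected_space)
  then have oe: "openin R e" using G openin_trans_full by blast
  have "connectedin (subtopology R G) e"
    using e by (rule connectedin_connected_components_of)
  then have eG: "e \<subseteq> G" and ce: "connectedin R e"
    by (auto simp: connectedin_subtopology)
  then show "connectedin R e" by simp
  obtain p where p: "p \<in> e"
    using nonempty_connected_components_of[OF e] by auto
  define \<S> where "\<S> = {S. real_chart R f S \<and> connectedin R S \<and> p \<in> S \<and> S \<subseteq> e}"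
  have *: "\<exists>S. real_chart R f S \<and> connectedin R S \<and> x \<in> S \<and> S \<subseteq> e" if "x \<in> e" for x
    using regular_at_connected_chart[OF lc _ oe that] reg eG that by (metis subsetD)
  have oS: "openin R (\<Union>\<S>)"
    unfolding \<S>_def real_chart_def by (intro openin_Union) auto
  have union: "real_chart R f (S \<union> T)" if "S \<in> \<S>" "T \<in> \<S>" for S T
    using that real_chart_union[OF H f] unfolding \<S>_def by blast
  have "e \<subseteq> \<Union>\<S>"
  proof (rule ccontr)
    assume "\<not> e \<subseteq> \<Union>\<S>"
    have "\<exists>U. openin R U \<and> x \<in> U \<and> U \<subseteq> e - \<Union>\<S>" if x: "x \<in> e - \<Union>\<S>" for x
    proof -
      obtain T where T: "real_chart R f T" "connectedin R T" "x \<in> T" "T \<subseteq> e"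
        using *[of x] x by blast
      have "T \<inter> \<Union>\<S> = {}"
      proof (rule ccontr)
        assume "T \<inter> \<Union>\<S> \<noteq> {}"
        then obtain S where S: "S \<in> \<S>" "S \<inter> T \<noteq> {}" by auto
        then have "S \<union> T \<in> \<S>"
          using T real_chart_union[OF H f] connectedin_Un unfolding \<S>_def by blast
        then show False using x T by auto
      qed
      then show ?thesis using T unfolding real_chart_def by auto
    qed
    then have "openin R (e - \<Union>\<S>)" by (subst openin_subopen) auto
    moreover have "e \<inter> \<Union>\<S> \<noteq> {}" using *[OF p] p unfolding \<S>_def by auto
    moreover have "\<Union>\<S> \<subseteq> e" unfolding \<S>_def by auto
    ultimately show False
      using connectedinD[OF ce oS, of "e - \<Union>\<S>"] \<open>\<not> e \<subseteq> \<Union>\<S>\<close> by auto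
  qed
  then have eS: "e = \<Union>\<S>" unfolding \<S>_def by auto
  have "inj_on f e"
  proof (rule inj_onI)
    fix x y assume "x \<in> e" "y \<in> e" and eq: "f x = f y"
    then obtain S T where "S \<in> \<S>" "T \<in> \<S>" "x \<in> S" "y \<in> T" using eS by auto
    then show "x = y" using union[of S T] eq by (auto simp: real_chart_def inj_on_def)
  qed
  moreover have "open (f ` B)" if B: "openin R B" "B \<subseteq> e" for B
  proof -
    have "f ` B = \<Union>((\<lambda>S. f ` (B \<inter> S)) ` \<S>)" using B eS by auto
    moreover have "open (f ` (B \<inter> S))" if "S \<in> \<S>" for S
      using that B unfolding \<S>_def real_chart_def by auto
    ultimately show ?thesis by auto
  qed
  ultimately show "real_chart R f e" using oe by (auto simp: real_chart_def)
qed

section \<open>Cell structure off a closed discrete set\<close>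

text \<open>
  An arc whose closure reaches \<open>x\<close> at its upper end stays in a connected neighbourhood \<open>U\<close> of \<open>x\<close>
  once it has entered it.  If it left \<open>U\<close> at \<open>y\<close>, the part of \<open>U \<inter> e\<close> below \<open>y\<close> would be open and
  closed in \<open>U\<close> without containing \<open>x\<close>, as the arc has no other limit point in \<open>U\<close>.  Local
  connectedness thus takes the place of local compactness: the arc converges to \<open>x\<close>.
\<close>

lemma edge_end_tail:
  assumes f: "continuous_map R euclideanreal f"
    and e: "real_chart R f e"
    and U: "openin R U" "connectedin R U" and x: "x \<in> U"
    and frontier: "U \<inter> (R closure_of e - e) \<subseteq> {x}"
    and top: "\<And>y. y \<in> e \<Longrightarrow> f y < f x"
    and z: "z \<in> e" "z \<in> U" and y: "y \<in> e" "f z < f y"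
  shows "y \<in> U"
proof (rule ccontr)
  assume "y \<notin> U"
  have oe: "openin R e" and inj: "inj_on f e" using e by (auto simp: real_chart_def)
  define A where "A = {u \<in> topspace R. f u < f y} \<inter> (U \<inter> e)"
  define B where "B = ({u \<in> topspace R. f u > f y} \<inter> U) \<union> (U - R closure_of e)"
  have A: "openin R A"
    using f U oe unfolding A_def continuous_map_upper_lower_semicontinuous_lt by auto
  have B: "openin R B"
    using f U(1) unfolding B_def continuous_map_upper_lower_semicontinuous_lt
    by (intro openin_Un openin_Int openin_diff) auto
  have sub: "U \<subseteq> topspace R" "e \<subseteq> R closure_of e"
    using U oe openin_subset closure_of_subset by metis+
  have "U \<subseteq> A \<union> B"
  proof
    fix u assume u: "u \<in> U"
    have "u \<in> e \<Longrightarrow> f u \<noteq> f y" using inj y u \<open>y \<notin> U\<close> by (auto simp: inj_on_def)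
    moreover have "u \<in> R closure_of e - e \<Longrightarrow> f u > f y" using frontier u top y by auto
    ultimately show "u \<in> A \<union> B" using u sub unfolding A_def B_def by fastforce
  qed
  moreover have "A \<inter> B \<inter> U = {}" using sub unfolding A_def B_def by auto
  moreover have "z \<in> A \<inter> U" using z y sub unfolding A_def by auto
  moreover have "x \<in> B \<inter> U" using x top[OF y(1)] sub unfolding B_def by auto
  ultimately show False using connectedinD[OF U(2) A B] by auto
qed

lemma closed_discrete_isolating:
  assumes "locally_connected_space R" "closed_discrete_in R Z" "openin R G" "x \<in> G"
  obtains U where "openin R U" "connectedin R U" "x \<in> U" "U \<inter> Z \<subseteq> {x}" "U \<subseteq> G"
proof -
  have Z: "closedin R Z" "subtopology R Z = discrete_topology Z"
    using assms by (auto simp: closed_discrete_in_def)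
  have "closedin R (Z - {x})"
    using closedin_trans_full[of R Z "Z - {x}"] Z by auto
  then have "openin R (G - (Z - {x}))" using assms by (auto intro: openin_diff)
  then obtain U where "openin R U" "connectedin R U" "x \<in> U" "U \<subseteq> G - (Z - {x})"
    using assms unfolding locally_connected_space by (metis DiffI insertCI DiffD2)
  then show ?thesis using that by blast
qed

text \<open>
  The function itself parametrizes the closure of the arc.  It maps the arc onto an interval
  \<open>(a, b)\<close>.  A frontier point lies over \<open>a\<close> or \<open>b\<close>: over an inner value, it would be separated from
  the point of the arc with that value, although nearby values are taken only near the latter.
  Each end has at most one limit point, by \<open>edge_end_tail\<close> and the Hausdorff property.  Hence
  the function is injective on the closure, and \<open>edge_end_tail\<close> also makes it open onto
  its image there.  The inverse, after an affine change of parameter, is the characteristic map;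
  an end without limit point is left out of its domain \<open>J\<close>.
\<close>

lemma edge_one_cell_bounded:
  assumes H: "Hausdorff_space R" and lc: "locally_connected_space R"
    and f: "continuous_map R euclideanreal f" and bdd: "bounded (f ` topspace R)"
    and Z: "closed_discrete_in R Z"
    and e: "real_chart R f e" "connectedin R e" "e \<noteq> {}"
    and frontier: "R closure_of e - e \<subseteq> Z"
  shows "one_cell R Z e"
proof -
  define C where "C = R closure_of e"
  have oe: "openin R e" and inj: "inj_on f e" using e by (auto simp: real_chart_def)
  have sub: "C \<subseteq> topspace R" "e \<subseteq> C" "e \<subseteq> topspace R"
    unfolding C_def using oe openin_subset closure_of_subset closure_of_subset_topspace by metis+
  have ofe: "open (f ` e)" using e oe by (auto simp: real_chart_def)
  have cfe: "connected (f ` e)" using connectedin_continuous_map_image[OF f e(2)] by simp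
  obtain a b where ab: "f ` e = {a<..<b}"
  proof -
    have "bounded (f ` e)" using bdd sub by (meson bounded_subset image_mono)
    then have bd: "bdd_below (f ` e)" "bdd_above (f ` e)"
      by (auto simp: bounded_imp_bdd_below bounded_imp_bdd_above)
    have "f ` e = {Inf (f ` e)<..<Sup (f ` e)}"
    proof
      show "f ` e \<subseteq> {Inf (f ` e)<..<Sup (f ` e)}"
      proof
        fix t assume t: "t \<in> f ` e"
        obtain d where d: "d > 0" "cball t d \<subseteq> f ` e" using ofe t open_contains_cball by blast
        then have "t - d \<in> f ` e" "t + d \<in> f ` e" by (auto simp: subset_iff dist_real_def)
        then show "t \<in> {Inf (f ` e)<..<Sup (f ` e)}"
          using bd d cInf_lower[of "t - d" "f ` e"] cSup_upper[of "t + d" "f ` e"] by auto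
      qed
      show "{Inf (f ` e)<..<Sup (f ` e)} \<subseteq> f ` e"
      proof
        fix t assume t: "t \<in> {Inf (f ` e)<..<Sup (f ` e)}"
        then obtain u v where "u \<in> f ` e" "u < t" "v \<in> f ` e" "t < v"
          using cInf_lessD[of "f ` e" t] less_cSupD[of "f ` e" t] e(3) by auto
        then show "t \<in> f ` e" using cfe connected_contains_Icc[of "f ` e" u v] by auto
      qed
    qed
    then show ?thesis using that by blast
  qed
  have "a < b" using ab e(3) by (metis empty_is_image greaterThanLessThan_empty_iff not_le)
  have fC: "f x \<in> {a..b}" if "x \<in> C" for x
  proof -
    have "f x \<in> closure (f ` e)"
      using continuous_map_image_closure_subset[OF f, of e] that by (auto simp: C_def)
    then show ?thesis using ab \<open>a < b\<close> by simp
  qed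
  have fend: "f x = a \<or> f x = b" if x: "x \<in> C" "x \<notin> e" for x
  proof (rule ccontr)
    assume "\<not> (f x = a \<or> f x = b)"
    then have "f x \<in> f ` e" using fC[OF x(1)] ab by auto
    then obtain y where y: "y \<in> e" "f y = f x" by auto
    then have "x \<noteq> y" using x by auto
    then obtain P Q where PQ: "openin R P" "openin R Q" "x \<in> P" "y \<in> Q" "disjnt P Q"
      using Hausdorff_spaceE[OF H, of x y] x y sub by blast
    have "open (f ` (Q \<inter> e))" using e(1) PQ oe by (auto simp: real_chart_def)
    then have "openin R {u \<in> topspace R. f u \<in> f ` (Q \<inter> e)}"
      using f by (auto simp: continuous_map_def)
    then have "openin R (P \<inter> {u \<in> topspace R. f u \<in> f ` (Q \<inter> e)})" using openin_Int[OF PQ(1)] by simp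
    moreover have "x \<in> P \<inter> {u \<in> topspace R. f u \<in> f ` (Q \<inter> e)}" using PQ(3,4) x y(2)[symmetric] y(1) sub by blast
    ultimately obtain u where u: "u \<in> e" "u \<in> P" "f u \<in> f ` (Q \<inter> e)"
      using closure_of_meets_open[OF x(1)[unfolded C_def]] by blast
    then obtain w where "w \<in> Q" "w \<in> e" "f w = f u" by auto
    then have "w = u" using inj u by (auto simp: inj_on_def)
    then show False using \<open>w \<in> Q\<close> u PQ by (auto simp: disjnt_iff)
  qed
  \<comment> \<open>The sign \<open>s\<close> treats the upper end (\<open>s = 1\<close>) and the lower end (\<open>s = -1\<close>) together.\<close>
  have tail: "\<exists>z\<in>e. \<forall>y\<in>e. s * f z < s * f y \<longrightarrow> y \<in> G"
    if x: "x \<in> C" "x \<notin> e" and s: "s = 1 \<and> f x = b \<or> s = -1 \<and> f x = a" and G: "openin R G" "x \<in> G"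
    for x G and s :: real
  proof -
    obtain U where U: "openin R U" "connectedin R U" "x \<in> U" "U \<inter> Z \<subseteq> {x}" "U \<subseteq> G"
      by (rule closed_discrete_isolating[OF lc Z G])
    obtain z where z: "z \<in> e" "z \<in> U" using closure_of_meets_open[OF x(1)[unfolded C_def] U(1,3)] by blast
    have fr: "U \<inter> (R closure_of e - e) \<subseteq> {x}" using U frontier by auto
    have "y \<in> G" if y: "y \<in> e" "s * f z < s * f y" for y
    proof (cases "s = 1")
      case True
      have "f w < f x" if "w \<in> e" for w using that ab s True by auto
      then have "y \<in> U" using edge_end_tail[OF f e(1) U(1-3) fr _ z, of y] y True by auto
      then show ?thesis using U by auto
    next
      case False
      have f': "continuous_map R euclideanreal (\<lambda>x. - f x)"
        using f by (simp add: continuous_map_minus)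
      have "- f w < - f x" if "w \<in> e" for w using that ab s False by auto
      then have "y \<in> U"
        using edge_end_tail[OF f' real_chart_uminus[OF e(1)] U(1-3) fr _ z, of y] y s False by auto
      then show ?thesis using U by auto
    qed
    then show ?thesis using z by blast
  qed
  have endeq: "x = x'" if x: "x \<in> C" "x \<notin> e" and x': "x' \<in> C" "x' \<notin> e" and eq: "f x = f x'" for x x'
  proof (rule ccontr)
    assume "x \<noteq> x'"
    then obtain P Q where PQ: "openin R P" "openin R Q" "x \<in> P" "x' \<in> Q" "disjnt P Q"
      using Hausdorff_spaceE[OF H, of x x'] x x' sub by blast
    obtain s :: real where s: "s = 1 \<and> f x = b \<or> s = -1 \<and> f x = a" using fend[OF x] by auto
    obtain z where z: "z \<in> e" "\<forall>y\<in>e. s * f z < s * f y \<longrightarrow> y \<in> P"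
      using tail[OF x s PQ(1,3)] by auto
    obtain z' where z': "z' \<in> e" "\<forall>y\<in>e. s * f z' < s * f y \<longrightarrow> y \<in> Q"
      using tail[OF x' _ PQ(2,4), of s] s eq by auto
    have fz: "f z \<in> {a<..<b}" "f z' \<in> {a<..<b}" unfolding ab[symmetric] using z z' by auto
    have "\<exists>t\<in>{a<..<b}. s * f z < s * t \<and> s * f z' < s * t"
    proof (cases "s = 1")
      case True
      have "max (f z) (f z') < b" "a < max (f z) (f z')" using fz by auto
      then show ?thesis using True
        by (intro bexI[of _ "(max (f z) (f z') + b) / 2"]) (auto simp: field_simps)
    next
      case False
      have "a < min (f z) (f z')" "min (f z) (f z') < b" using fz by auto
      then show ?thesis using False s
        by (intro bexI[of _ "(min (f z) (f z') + a) / 2"]) (auto simp: field_simps)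
    qed
    then obtain y where "y \<in> e" "s * f z < s * f y" "s * f z' < s * f y" using ab by (metis imageE)
    then show False using z z' PQ by (auto simp: disjnt_iff)
  qed
  have injC: "inj_on f C"
  proof (rule inj_onI)
    fix x y assume xy: "x \<in> C" "y \<in> C" "f x = f y"
    have *: "u \<in> e \<Longrightarrow> f u \<noteq> a \<and> f u \<noteq> b" for u
      using imageI[of u e f] unfolding ab by auto
    show "x = y"
      using xy inj endeq[of x y] fend[of x] fend[of y] *[of x] *[of y] by (metis inj_onD)
  qed
  define g where "g = (\<lambda>x. (f x - a) / (b - a))"
  define J where "J = g ` C"
  have g_less: "g x < g y \<longleftrightarrow> f x < f y" for x y
    using \<open>a < b\<close> by (simp add: g_def divide_less_cancel)
  have g_eq: "g x = g y \<longleftrightarrow> f x = f y" for x y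
    using \<open>a < b\<close> by (simp add: g_def)
  have ge: "g ` e = {0<..<1}"
  proof -
    have "g ` e = (\<lambda>t. (t - a) / (b - a)) ` {a<..<b}" by (simp add: g_def image_image flip: ab)
    also have "\<dots> = {0<..<1}"
    proof (intro set_eqI iffI)
      fix t assume "t \<in> {0<..<1::real}"
      then have t: "0 < t" "t < 1" by auto
      have "t = ((a + t * (b - a)) - a) / (b - a)" using \<open>a < b\<close> by simp
      moreover have "0 < t * (b - a)" "t * (b - a) < 1 * (b - a)"
        using t \<open>a < b\<close> by (intro mult_pos_pos mult_strict_right_mono; simp)+
      then have "a + t * (b - a) \<in> {a<..<b}" by simp
      ultimately show "t \<in> (\<lambda>t. (t - a) / (b - a)) ` {a<..<b}" by (metis (no_types) image_eqI)
    qed (use \<open>a < b\<close> in auto)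
    finally show ?thesis .
  qed
  have J: "{0<..<1} \<subseteq> J" "J \<subseteq> {0..1}"
  proof -
    show "{0<..<1} \<subseteq> J" unfolding J_def ge[symmetric] using sub by auto
    show "J \<subseteq> {0..1}" unfolding J_def g_def using fC \<open>a < b\<close> by (auto simp: field_simps)
  qed
  have gcont: "continuous_map R euclideanreal g"
    unfolding g_def by (intro continuous_intros f) (use \<open>a < b\<close> in auto)
  have gchart: "open (g ` B)" if "openin R B" "B \<subseteq> e" for B
  proof -
    have "open (f ` B)" using e(1) that by (auto simp: real_chart_def)
    moreover have "g ` B = (\<lambda>t. t / (b - a)) ` ((\<lambda>t. - a + t) ` f ` B)"
      by (auto simp: g_def image_image)
    moreover have "\<dots> = (\<lambda>t. (1 / (b - a)) *\<^sub>R t) ` ((\<lambda>t. - a + t) ` f ` B)"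
      by (simp add: field_simps)
    ultimately show ?thesis using \<open>a < b\<close> open_scaling[of "1 / (b - a)"] open_translation by (metis
      diff_gt_0_iff_gt less_irrefl zero_less_divide_1_iff)
  qed
  have hom: "homeomorphic_map (subtopology R C) (top_of_set J) g"
  proof (rule bijective_open_imp_homeomorphic_map)
    show "continuous_map (subtopology R C) (top_of_set J) g"
      using gcont sub by (auto simp: continuous_map_in_subtopology continuous_map_from_subtopology J_def)
    show "g ` topspace (subtopology R C) = topspace (top_of_set J)"
      using sub by (simp add: J_def Int_absorb1)
    show "inj_on g (topspace (subtopology R C))"
      using injC by (auto simp: inj_on_def g_eq)
    show "open_map (subtopology R C) (top_of_set J) g"
      unfolding open_map_def
    proof (intro allI impI)
      fix B assume "openin (subtopology R C) B"
      then obtain G where G: "openin R G" "B = G \<inter> C" by (auto simp: openin_subtopology)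
      have "\<exists>T. open T \<and> g x \<in> T \<and> J \<inter> T \<subseteq> g ` B" if x: "x \<in> B" for x
      proof (cases "x \<in> e")
        case True
        then show ?thesis
          using gchart[of "G \<inter> e"] G oe x sub by (intro exI[of _ "g ` (G \<inter> e)"]) auto
      next
        case False
        have xC: "x \<in> C" using x G by auto
        obtain s :: real where s: "s = 1 \<and> f x = b \<or> s = -1 \<and> f x = a" using fend[OF xC False] by auto
        obtain z where z: "z \<in> e" "\<forall>y\<in>e. s * f z < s * f y \<longrightarrow> y \<in> G"
          using tail[OF xC False s G(1)] x G by auto
        let ?T = "{t. s * g z < s * t}"
        have "open ?T" by (intro open_Collect_less continuous_intros)
        moreover have sg: "s * g u < s * g v \<longleftrightarrow> s * f u < s * f v" for u v
          using s g_less by auto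
        moreover have "s * f z < s * f x" using s z ab by force
        moreover have "J \<inter> ?T \<subseteq> g ` B"
        proof
          fix t assume "t \<in> J \<inter> ?T"
          then obtain y where y: "y \<in> C" "t = g y" "s * f z < s * f y" using sg by (auto simp: J_def)
          have "y \<in> B"
          proof (cases "y \<in> e")
            case True then show ?thesis using z y G by auto
          next
            case F: False
            have "f z \<in> {a<..<b}" using z ab by auto
            then have "f y = f x" using s fend[OF y(1) F] y(3) by auto
            then show ?thesis using endeq[OF y(1) F xC False] x by auto
          qed
          then show "t \<in> g ` B" using y by auto
        qed
        ultimately show ?thesis by (intro exI[of _ ?T]) auto
      qed
      moreover have "g ` B \<subseteq> J" using G by (auto simp: J_def)
      ultimately show "openin (top_of_set J) (g ` B)"
        by (subst openin_subopen) (metis (no_types, lifting) IntI Int_commute imageE openin_open_Int subsetD)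
    qed
  qed
  then obtain h where hm: "homeomorphic_maps (subtopology R C) (top_of_set J) g h"
    by (auto simp: homeomorphic_map_maps)
  have hg: "h (g x) = x" if "x \<in> C" for x
    using hm that sub by (auto simp: homeomorphic_maps_def)
  have hm': "homeomorphic_maps (top_of_set J) (subtopology R C) h g"
    using hm homeomorphic_maps_sym by blast
  have "quotient_map (top_of_set J) (subtopology R C) h"
    using hm' by (simp add: homeomorphic_maps_map homeomorphic_map_def)
  moreover have "homeomorphic_map (top_of_set {0<..<1}) (subtopology R e) h"
  proof -
    have "h ` {0<..<1} = e"
      using hg sub unfolding ge[symmetric] by force
    then have "h ` (topspace (top_of_set J) \<inter> {0<..<1}) = topspace (subtopology R C) \<inter> e"
      using J sub by (simp add: Int_absorb1)
    then have "homeomorphic_maps (subtopology (top_of_set J) {0<..<1}) (subtopology (subtopology R C) e) h g"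
      using homeomorphic_maps_subtopologies[OF hm'] by blast
    then show ?thesis
      using J(1) sub by (auto simp: subtopology_subtopology Int_absorb1 homeomorphic_map_maps)
  qed
  moreover have "h ` (J - {0<..<1}) \<subseteq> Z"
  proof
    fix z assume "z \<in> h ` (J - {0<..<1})"
    then obtain x where x: "x \<in> C" "z = h (g x)" "g x \<notin> {0<..<1}" by (auto simp: J_def)
    then have "x \<notin> e" using ge by auto
    then show "z \<in> Z" using x hg frontier by (auto simp: C_def)
  qed
  ultimately show ?thesis
    unfolding one_cell_def C_def[symmetric] using J by blast
qed

text \<open>
  Composing with \<open>arctan\<close> turns unbounded ends of the parameter interval into finite ends at which
  no point of the space lies.
\<close>

lemma edge_one_cell:
  assumes H: "Hausdorff_space R" and lc: "locally_connected_space R"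
    and f: "continuous_map R euclideanreal f"
    and Z: "closed_discrete_in R Z"
    and e: "real_chart R f e" "connectedin R e" "e \<noteq> {}"
    and frontier: "R closure_of e - e \<subseteq> Z"
  shows "one_cell R Z e"
proof (rule edge_one_cell_bounded[OF H lc _ _ Z real_chart_arctan[OF e(1)] e(2,3) frontier])
  show "continuous_map R euclideanreal (arctan \<circ> f)"
    by (rule continuous_map_compose[OF f]) (auto intro!: continuous_intros)
  have "(arctan \<circ> f) ` topspace R \<subseteq> {- (pi/2)..pi/2}"
    using arctan_lbound arctan_ubound by (auto simp: less_imp_le)
  then show "bounded ((arctan \<circ> f) ` topspace R)"
    using bounded_closed_interval bounded_subset by blast
qed

text \<open>
  The edges are the components of the complement of \<open>Z\<close>.  For the closedness of a union of closed
  edges, consider a connected neighbourhood of a vertex \<open>x\<close> that contains no other vertex.  An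
  edge that meets it without having \<open>x\<close> in its closure would be open and closed in it.  So this
  neighbourhood meets only edges that end at \<open>x\<close>, even if infinitely many do.
\<close>

theorem regular_off_discrete_imp_CW:
  assumes H: "Hausdorff_space R" and lc: "locally_connected_space R"
    and f: "continuous_map R euclideanreal f"
    and Z: "closed_discrete_in R Z"
    and reg: "\<And>x. x \<in> topspace R - Z \<Longrightarrow> regular_at R f x"
  shows "CW_complex_1 R Z (connected_components_of (subtopology R (topspace R - Z)))"
proof -
  define G where "G = topspace R - Z"
  define \<E> where "\<E> = connected_components_of (subtopology R G)"
  have cZ: "closedin R Z" and ZR: "Z \<subseteq> topspace R"
    using Z closedin_subset by (auto simp: closed_discrete_in_def)
  then have G: "openin R G" by (auto simp: G_def)
  have UE: "\<Union>\<E> = G"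
    unfolding \<E>_def Union_connected_components_of using G openin_subset by fastforce
  have dis: "disjoint \<E>"
    unfolding \<E>_def using pairwise_disjoint_connected_components_of[of "subtopology R G"]
    by (simp add: disjoint_def pairwise_def disjnt_def)
  have chart: "real_chart R f e" "connectedin R e" "e \<noteq> {}" "openin R e" if "e \<in> \<E>" for e
    using component_real_chart[OF H lc f G _ that[unfolded \<E>_def]] reg
      nonempty_connected_components_of that
    by (auto simp: G_def \<E>_def real_chart_def)
  have fr: "R closure_of e - e \<subseteq> Z" if e: "e \<in> \<E>" for e
  proof
    fix x assume x: "x \<in> R closure_of e - e"
    show "x \<in> Z"
    proof (rule ccontr)
      assume "x \<notin> Z"
      then have "x \<in> G" using x by (auto simp: G_def in_closure_of)
      then obtain e' where e': "e' \<in> \<E>" "x \<in> e'" using UE by auto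
      then obtain y where "y \<in> e" "y \<in> e'"
        using closure_of_meets_open[OF _ chart(4), of x e e'] x by blast
      then have "e = e'" using dis e e' by (auto simp: disjoint_def)
      then show False using x e' by auto
    qed
  qed
  have cell: "one_cell R Z e" if e: "e \<in> \<E>" for e
    by (rule edge_one_cell[OF H lc f Z chart(1-3)[OF e] fr[OF e]])
  have "closedin R (\<Union>e\<in>\<E>'. R closure_of e)" if E': "\<E>' \<subseteq> \<E>" for \<E>'
  proof -
    let ?Y = "\<Union>e\<in>\<E>'. R closure_of e"
    have "\<exists>U. openin R U \<and> x \<in> U \<and> U \<subseteq> topspace R - ?Y" if x: "x \<in> topspace R - ?Y" for x
    proof (cases "x \<in> Z")
      case False
      then obtain e where e: "e \<in> \<E>" "x \<in> e" using x UE by (auto simp: G_def)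
      have "e \<inter> R closure_of e' = {}" if "e' \<in> \<E>'" for e'
      proof (rule ccontr)
        assume "e \<inter> R closure_of e' \<noteq> {}"
        then obtain y where "y \<in> e" "y \<in> e'"
          using closure_of_meets_open[OF _ chart(4)[OF e(1)]] by blast
        then have "e = e'" using dis e that E' by (auto simp: disjoint_def)
        then show False using x e that closure_of_subset[of e' R] chart(4)[OF e(1)] openin_subset by blast
      qed
      then show ?thesis using chart(4)[OF e(1)] e openin_subset by (intro exI[of _ e]) blast
    next
      case True
      obtain U where U: "openin R U" "connectedin R U" "x \<in> U" "U \<inter> Z \<subseteq> {x}"
        by (rule closed_discrete_isolating[OF lc Z openin_topspace, of x]) (use x in auto)
      have "U \<inter> R closure_of e = {}" if "e \<in> \<E>'" for e
      proof (rule ccontr)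
        assume ne: "U \<inter> R closure_of e \<noteq> {}"
        have e: "e \<in> \<E>" using that E' by auto
        have nx: "x \<notin> R closure_of e" using x that by auto
        have "U \<subseteq> e \<union> (topspace R - R closure_of e)"
          using fr[OF e] U nx openin_subset[OF U(1)] by auto
        moreover have "e \<inter> U \<noteq> {}" using ne fr[OF e] U nx by auto
        moreover have "e \<inter> (topspace R - R closure_of e) \<inter> U = {}"
          using closure_of_subset[of e R] chart(4)[OF e] openin_subset by blast
        moreover have "(topspace R - R closure_of e) \<inter> U \<noteq> {}" using x U nx by auto
        ultimately show False
          using connectedinD[OF U(2) chart(4)[OF e] openin_diff[OF openin_topspace closedin_closure_of]]
          by metis
      qed
      then show ?thesis using U openin_subset by (intro exI[of _ U]) blast
    qed
    then have "openin R (topspace R - ?Y)" by (subst openin_subopen) auto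
    moreover have "?Y \<subseteq> topspace R" using closure_of_subset_topspace by fastforce
    ultimately show ?thesis by (simp add: closedin_def)
  qed
  then show ?thesis
    unfolding CW_complex_1_def \<E>_def[symmetric] G_def[symmetric] UE
    using H Z dis cell ZR by (auto simp: G_def)
qed

section \<open>Finiteness of fibres over compact pieces\<close>

lemma compactin_isolated_imp_finite:
  assumes K: "compactin R K" and iso: "\<And>x. x \<in> K \<Longrightarrow> \<exists>U. openin R U \<and> x \<in> U \<and> U \<inter> K \<subseteq> {x}"
  shows "finite K"
proof -
  have "openin (subtopology R K) {x}" if x: "x \<in> K" for x
  proof -
    obtain U where "openin R U" "x \<in> U" "U \<inter> K \<subseteq> {x}" using iso[OF x] by auto
    moreover from this x have "{x} = U \<inter> K" by auto
    ultimately show ?thesis by (metis openin_subtopology)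
  qed
  moreover have "topspace (subtopology R K) = K"
    using compactin_subset_topspace[OF K] by auto
  ultimately have "discrete_topology K = subtopology R K"
    by (simp add: discrete_topology_unique)
  moreover have "compact_space (subtopology R K)" using K by (rule compact_space_subtopology)
  ultimately show ?thesis by (metis compact_space_discrete_topology)
qed

lemma fibre_compactin:
  assumes "continuous_map R euclideanreal f" "compactin R U"
  shows "compactin R {u \<in> U. f u = v}"
proof -
  have "closedin R {u \<in> topspace R. f u \<in> {v}}"
    by (rule closedin_continuous_map_preimage[OF assms(1)]) auto
  then have "compactin R (U \<inter> {u \<in> topspace R. f u \<in> {v}})"
    using assms(2) by (rule compact_Int_closedin[rotated])
  moreover have "U \<inter> {u \<in> topspace R. f u \<in> {v}} = {u \<in> U. f u = v}"
    using compactin_subset_topspace[OF assms(2)] by auto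
  ultimately show ?thesis by simp
qed

text \<open>
  All points over the interval \<open>(v, v + \<epsilon>)\<close> are regular, so each component of the part of \<open>U\<close> over it
  is an arc.  By
  compactness its values cannot stop inside the interval, so it meets the middle level, whose
  fibre is finite; hence there are finitely many arcs.  Each arc approaches at most one point of the
  fibre over \<open>v\<close>: if \<open>A\<close> and \<open>B\<close> separate two such points and cover the piece near that fibre, the
  values of the arc near \<open>v\<close> split into two disjoint open sets, although they fill an interval.
\<close>

lemma finite_upper_ends:
  assumes H: "Hausdorff_space R" and lc: "locally_connected_space R"
    and f: "continuous_map R euclideanreal f"
    and U: "compactin R U" "openin R U"
    and \<epsilon>: "\<epsilon> > 0" and reg: "\<And>x. x \<in> U \<Longrightarrow> f x \<in> {v<..<v+\<epsilon>} \<Longrightarrow> regular_at R f x"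
    and sep: "\<And>r s. \<lbrakk>r \<in> U; s \<in> U; r \<noteq> s; f r = v; f s = v\<rbrakk> \<Longrightarrow>
       \<exists>\<delta>>0. \<exists>A B. openin R A \<and> openin R B \<and> A \<inter> B = {} \<and> r \<in> A \<and> s \<in> B \<and> {u \<in> U. \<bar>f u - v\<bar> < \<delta>} \<subseteq> A \<union> B"
  shows "finite {x \<in> U. f x = v \<and> x \<in> R closure_of {u \<in> U. v < f u}}"
proof -
  define G where "G = U \<inter> {u \<in> topspace R. f u \<in> {v<..<v+\<epsilon>}}"
  define \<E> where "\<E> = connected_components_of (subtopology R G)"
  define w where "w = v + \<epsilon> / 2"
  have cU: "closedin R U" using H U(1) by (rule compactin_imp_closedin)
  have UR: "U \<subseteq> topspace R" using U(2) openin_subset by auto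
  have "openin R {u \<in> topspace R. f u \<in> {v<..<v+\<epsilon>}}"
    by (rule openin_continuous_map_preimage[OF f]) auto
  then have G: "openin R G" unfolding G_def using U(2) by (intro openin_Int)
  have UE: "\<Union>\<E> = G"
    unfolding \<E>_def Union_connected_components_of using G openin_subset by fastforce
  have chart: "real_chart R f e" "connectedin R e" "e \<noteq> {}" "openin R e" if "e \<in> \<E>" for e
    using component_real_chart[OF H lc f G _ that[unfolded \<E>_def]] reg
      nonempty_connected_components_of that
    by (auto simp: G_def \<E>_def real_chart_def)
  have hit: "\<exists>u\<in>e. f u = w" if e: "e \<in> \<E>" for e
  proof (rule ccontr)
    assume "\<not> (\<exists>u\<in>e. f u = w)"
    then have w: "w \<notin> f ` e" by auto
    have eG: "e \<subseteq> G" using e UE by auto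
    have ofe: "open (f ` e)" using chart[OF e] by (auto simp: real_chart_def)
    have fe: "f ` e \<subseteq> {v<..<v+\<epsilon>}" using eG by (auto simp: G_def)
    have "\<exists>b\<in>{v<..<v+\<epsilon>}. b \<in> closure (f ` e) \<and> b \<notin> f ` e"
    proof (rule ccontr)
      assume no: "\<not> ?thesis"
      have "{v<..<v+\<epsilon>} \<subseteq> f ` e \<union> - closure (f ` e)" using no by auto
      moreover have "w \<in> {v<..<v+\<epsilon>}" using \<epsilon> by (auto simp: w_def)
      then have "- closure (f ` e) \<inter> {v<..<v+\<epsilon>} \<noteq> {}" using no w by blast
      moreover have "f ` e \<inter> {v<..<v+\<epsilon>} \<noteq> {}" using fe chart(3)[OF e] by auto
      moreover have "f ` e \<inter> - closure (f ` e) \<inter> {v<..<v+\<epsilon>} = {}" using closure_subset[of "f ` e"] by auto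
      moreover have "connected {v<..<v+\<epsilon>}" by simp
      ultimately show False
        using ofe connectedD[of "{v<..<v+\<epsilon>}" "f ` e" "- closure (f ` e)"] by auto
    qed
    then obtain b where b: "b \<in> {v<..<v+\<epsilon>}" "b \<in> closure (f ` e)" "b \<notin> f ` e" by auto
    have "R closure_of e \<subseteq> U" using cU eG by (simp add: G_def closure_of_minimal)
    then have "compactin R (R closure_of e)"
      using closed_compactin[OF U(1)] by (meson closedin_closure_of)
    then have "compact (f ` (R closure_of e))" using image_compactin[OF _ f] by fastforce
    moreover have "f ` e \<subseteq> f ` (R closure_of e)"
      using closure_of_subset[of e R] openin_subset[OF chart(4)[OF e]] by auto
    ultimately have "b \<in> f ` (R closure_of e)"
      using b(2) closure_minimal compact_imp_closed by blast
    then obtain x where x: "x \<in> R closure_of e" "f x = b" by auto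
    then have "x \<in> G" using b(1) \<open>R closure_of e \<subseteq> U\<close> UR by (auto simp: G_def)
    then obtain e' where e': "e' \<in> \<E>" "x \<in> e'" using UE by auto
    obtain y where "y \<in> e" "y \<in> e'" using closure_of_meets_open[OF x(1) chart(4)] e' by metis
    then have "e = e'" using e e' connected_components_of_overlap unfolding \<E>_def by blast
    then show False using e' x b by auto
  qed
  have "finite {u \<in> U. f u = w}"
  proof (rule compactin_isolated_imp_finite[OF fibre_compactin[OF f U(1)]])
    fix x assume x: "x \<in> {u \<in> U. f u = w}"
    then obtain A where "x \<in> A" "real_chart R f A"
      using reg[of x] \<epsilon> by (auto simp: w_def regular_at_def)
    then show "\<exists>A. openin R A \<and> x \<in> A \<and> A \<inter> {u \<in> U. f u = w} \<subseteq> {x}"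
      using x by (intro exI[of _ A]) (auto simp: real_chart_def inj_on_def)
  qed
  moreover have "\<E> \<subseteq> (\<lambda>u. connected_component_of_set (subtopology R G) u) ` {u \<in> U. f u = w}"
  proof
    fix e assume e: "e \<in> \<E>"
    then obtain u where u: "u \<in> e" "f u = w" using hit by auto
    then have "u \<in> U" using e UE by (auto simp: G_def)
    moreover obtain x where x: "e = connected_component_of_set (subtopology R G) x"
      using e unfolding \<E>_def connected_components_of_def by auto
    then have "connected_component_of (subtopology R G) x u" using u by simp
    then have "e = connected_component_of_set (subtopology R G) u"
      unfolding x by (metis connected_component_of_equiv)
    ultimately show "e \<in> (\<lambda>u. connected_component_of_set (subtopology R G) u) ` {u \<in> U. f u = w}"
      using u by auto
  qed
  ultimately have finE: "finite \<E>" by (metis finite_imageI finite_subset)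
  have one: "x = y" if e: "e \<in> \<E>" and x: "x \<in> R closure_of e" "x \<in> U" "f x = v"
    and y: "y \<in> R closure_of e" "y \<in> U" "f y = v" for e x y
  proof (rule ccontr)
    assume "x \<noteq> y"
    then obtain \<delta> A B where \<delta>: "\<delta> > 0" and AB: "openin R A" "openin R B" "A \<inter> B = {}" "x \<in> A" "y \<in> B"
      and cov: "{u \<in> U. \<bar>f u - v\<bar> < \<delta>} \<subseteq> A \<union> B"
      using sep[of x y] x y by blast
    define N where "N = {u \<in> topspace R. f u \<in> {..<v+\<delta>}}"
    have N: "openin R N" unfolding N_def
      by (rule openin_continuous_map_preimage[OF f]) auto
    have eG: "e \<subseteq> G" using e UE by auto
    have "x \<in> A \<inter> N" "y \<in> B \<inter> N" using x y UR AB \<delta> by (auto simp: N_def)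
    then obtain p q where p: "p \<in> e" "p \<in> A \<inter> N" and q: "q \<in> e" "q \<in> B \<inter> N"
      using closure_of_meets_open[OF x(1) openin_Int[OF AB(1) N]]
        closure_of_meets_open[OF y(1) openin_Int[OF AB(2) N]] by metis
    let ?S = "closed_segment (f p) (f q)"
    have inj: "inj_on f e" using chart[OF e] by (auto simp: real_chart_def)
    have "open (f ` (e \<inter> A))" "open (f ` (e \<inter> B))"
      using chart[OF e] AB by (auto simp: real_chart_def)
    moreover have "?S \<subseteq> f ` (e \<inter> A) \<union> f ` (e \<inter> B)"
    proof
      fix t assume t: "t \<in> ?S"
      have "connected (f ` e)" using connectedin_continuous_map_image[OF f chart(2)[OF e]] by simp
      then have "?S \<subseteq> f ` e"
        using p q by (metis connected_contains_Icc closed_segment_eq_real_ivl image_eqI)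
      then obtain z where z: "z \<in> e" "f z = t" using t by auto
      have "t < v + \<delta>" using t p q by (auto simp: N_def closed_segment_eq_real_ivl split: if_splits)
      moreover have "v < f z" "z \<in> U" using z eG by (auto simp: G_def)
      ultimately have "z \<in> A \<union> B" using cov z by auto
      then show "t \<in> f ` (e \<inter> A) \<union> f ` (e \<inter> B)" using z by auto
    qed
    moreover have "f ` (e \<inter> A) \<inter> f ` (e \<inter> B) = {}"
      using inj AB by (auto simp: inj_on_def)
    moreover have "f p \<in> f ` (e \<inter> A) \<inter> ?S" "f q \<in> f ` (e \<inter> B) \<inter> ?S" using p q by auto
    ultimately show False
      using connectedD[OF connected_segment(1)[of "f p" "f q"], of "f ` (e \<inter> A)" "f ` (e \<inter> B)"]
      by auto
  qed
  have "{x \<in> U. f x = v \<and> x \<in> R closure_of {u \<in> U. v < f u}}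
     \<subseteq> (\<Union>e\<in>\<E>. {x \<in> U. f x = v \<and> x \<in> R closure_of e})"
  proof clarify
    fix x assume x: "x \<in> U" "v = f x" "x \<in> R closure_of {u \<in> U. f x < f u}"
    have "x \<in> R closure_of (\<Union>\<E>)"
      unfolding in_closure_of UE
    proof (intro conjI allI impI)
      show "x \<in> topspace R" using x UR by auto
      fix T assume T: "x \<in> T \<and> openin R T"
      have "openin R {u \<in> topspace R. f u \<in> {..<v+\<epsilon>}}"
        by (rule openin_continuous_map_preimage[OF f]) auto
      then have "openin R (T \<inter> {u \<in> topspace R. f u \<in> {..<v+\<epsilon>}})" using T by (metis openin_Int)
      then obtain y where "y \<in> {u \<in> U. f x < f u}" "y \<in> T \<inter> {u \<in> topspace R. f u \<in> {..<v+\<epsilon>}}"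
        by (rule closure_of_meets_open[OF x(3)]) (use T x UR \<epsilon> in auto)
      then show "\<exists>y. y \<in> G \<and> y \<in> T" using x by (auto simp: G_def)
    qed
    then have "x \<in> (\<Union>e\<in>\<E>. R closure_of e)"
      using finE by (simp add: closure_of_Union)
    then show "x \<in> (\<Union>e\<in>\<E>. {y \<in> U. f y = f x \<and> y \<in> R closure_of e})" using x by auto
  qed
  moreover have "finite {x \<in> U. f x = v \<and> x \<in> R closure_of e}" if e: "e \<in> \<E>" for e
  proof (cases "{x \<in> U. f x = v \<and> x \<in> R closure_of e} = {}")
    case False
    then obtain x where "x \<in> {x \<in> U. f x = v \<and> x \<in> R closure_of e}" by auto
    then have "{x \<in> U. f x = v \<and> x \<in> R closure_of e} \<subseteq> {x}" using one[OF e] by blast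
    then show ?thesis by (rule finite_subset) simp
  qed (metis finite.emptyI)
  ultimately show ?thesis using finE by (meson finite_UN_I finite_subset)
qed

text \<open>
  Finitely many points of the fibre are limits of points with larger or with smaller value.  At any
  other point \<open>r\<close> the function is constant on a connected neighbourhood, which reduces to \<open>{r}\<close>
  because the fibre is totally disconnected; so \<open>r\<close> is isolated in the whole space.  A connected
  neighbourhood of a fibre point cannot contain a different isolated point, so the compact fibre is
  discrete.
\<close>

lemma finite_fibre:
  assumes H: "Hausdorff_space R" and lc: "locally_connected_space R"
    and f: "continuous_map R euclideanreal f"
    and U: "compactin R U" "openin R U"
    and D: "finite D" and reg: "\<And>x. x \<in> U \<Longrightarrow> f x \<notin> D \<Longrightarrow> regular_at R f x"
    and sep: "\<And>r s. \<lbrakk>r \<in> U; s \<in> U; r \<noteq> s; f r = v; f s = v\<rbrakk> \<Longrightarrow>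
       \<exists>\<delta>>0. \<exists>A B. openin R A \<and> openin R B \<and> A \<inter> B = {} \<and> r \<in> A \<and> s \<in> B \<and> {u \<in> U. \<bar>f u - v\<bar> < \<delta>} \<subseteq> A \<union> B"
  shows "finite {u \<in> U. f u = v}"
proof -
  define F where "F = {u \<in> U. f u = v}"
  obtain \<epsilon> where \<epsilon>: "\<epsilon> > 0" "\<And>x. x \<in> D \<Longrightarrow> x \<noteq> v \<Longrightarrow> \<epsilon> \<le> dist v x"
    using finite_set_avoid[OF D, of v] by blast
  have UR: "U \<subseteq> topspace R" using U(2) openin_subset by auto
  have up: "finite {x \<in> U. f x = v \<and> x \<in> R closure_of {u \<in> U. v < f u}}"
  proof (rule finite_upper_ends[OF H lc f U \<epsilon>(1)])
    show "regular_at R f x" if "x \<in> U" "f x \<in> {v<..<v+\<epsilon>}" for x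
      using reg[OF that(1)] \<epsilon>(2)[of "f x"] that(2) by (force simp: dist_real_def)
  qed (use sep in auto)
  have f': "continuous_map R euclideanreal (\<lambda>x. - f x)"
    using f by (simp add: continuous_map_minus)
  have down: "finite {x \<in> U. - f x = - v \<and> x \<in> R closure_of {u \<in> U. - v < - f u}}"
  proof (rule finite_upper_ends[OF H lc f' U \<epsilon>(1)])
    show "regular_at R (\<lambda>x. - f x) x" if "x \<in> U" "- f x \<in> {- v<..<- v+\<epsilon>}" for x
    proof -
      have "f x \<notin> D" using \<epsilon>(2)[of "f x"] that(2) by (auto simp: dist_real_def)
      then show ?thesis using reg[OF that(1)] real_chart_uminus by (auto simp: regular_at_def)
    qed
    fix r s assume rs: "r \<in> U" "s \<in> U" "r \<noteq> s" "- f r = - v" "- f s = - v"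
    have "{u \<in> U. \<bar>- f u - - v\<bar> < \<delta>} = {u \<in> U. \<bar>f u - v\<bar> < \<delta>}" for \<delta> by auto
    then show "\<exists>\<delta>>0. \<exists>A B. openin R A \<and> openin R B \<and> A \<inter> B = {} \<and> r \<in> A \<and> s \<in> B \<and>
        {u \<in> U. \<bar>- f u - - v\<bar> < \<delta>} \<subseteq> A \<union> B"
      using sep[of r s] rs by simp
  qed
  define F0 where "F0 = {x \<in> U. f x = v \<and> x \<in> R closure_of {u \<in> U. v < f u}} \<union>
     {x \<in> U. - f x = - v \<and> x \<in> R closure_of {u \<in> U. - v < - f u}}"
  have F0: "finite F0" "F0 \<subseteq> topspace R" using up down UR by (auto simp: F0_def)
  have isolated: "openin R {r}" if r: "r \<in> F" "r \<notin> F0" for r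
  proof -
    let ?C = "R closure_of {u \<in> U. v < f u} \<union> R closure_of {u \<in> U. - v < - f u}"
    have "openin R (U - ?C)" using U(2) by (intro openin_diff closedin_Un) auto
    moreover have "r \<in> U - ?C" using r by (auto simp: F_def F0_def)
    ultimately obtain Q where Q: "openin R Q" "connectedin R Q" "r \<in> Q" "Q \<subseteq> U - ?C"
      by (rule locally_connected_spaceE[OF lc])
    have fQ: "f u = v" if "u \<in> Q" for u
    proof (rule ccontr)
      assume "f u \<noteq> v"
      then have "u \<in> {u \<in> U. v < f u} \<union> {u \<in> U. - v < - f u}" using that Q by auto
      moreover have "{u \<in> U. v < f u} \<union> {u \<in> U. - v < - f u} \<subseteq> ?C"
        using UR by (intro Un_mono closure_of_subset) auto
      ultimately show False using that Q by blast
    qed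
    have "Q \<subseteq> {r}"
    proof
      fix s assume s: "s \<in> Q"
      show "s \<in> {r}"
      proof (rule ccontr)
        assume "s \<notin> {r}"
        then have su: "s \<noteq> r" "r \<noteq> s" by auto
        have "s \<in> U" using Q(4) s by blast
        have ru: "r \<in> U" "f r = v" using r by (auto simp: F_def)
        then obtain \<delta> A B where \<delta>: "\<delta> > 0" and AB: "openin R A" "openin R B" "A \<inter> B = {}" "r \<in> A" "s \<in> B"
          and cov: "{u \<in> U. \<bar>f u - v\<bar> < \<delta>} \<subseteq> A \<union> B"
          using sep[of r s] su(2) \<open>s \<in> U\<close> ru fQ[OF s] by blast
        have "Q \<subseteq> A \<union> B" using cov fQ \<delta> Q by auto
        then show False using connectedinD[OF Q(2) AB(1,2)] AB(3-5) s Q(3) by blast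
      qed
    qed
    then have "Q = {r}" using Q by auto
    then show ?thesis using Q by simp
  qed
  have "finite F"
    unfolding F_def
  proof (rule compactin_isolated_imp_finite[OF fibre_compactin[OF f U(1)]], fold F_def)
    fix x assume x: "x \<in> F"
    have "closedin R (F0 - {x})"
      using F0 H Hausdorff_imp_t1_space closedin_Hausdorff_finite by (metis finite_Diff Diff_subset order_trans)
    then have "openin R (U - (F0 - {x}))" using U(2) by (intro openin_diff)
    moreover have "x \<in> U - (F0 - {x})" using x by (auto simp: F_def)
    ultimately obtain Q where Q: "openin R Q" "connectedin R Q" "x \<in> Q" "Q \<subseteq> U - (F0 - {x})"
      by (rule locally_connected_spaceE[OF lc])
    have "Q \<inter> F \<subseteq> {x}"
    proof
      fix r assume r: "r \<in> Q \<inter> F"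
      show "r \<in> {x}"
      proof (rule ccontr)
        assume "r \<notin> {x}"
        then have o: "openin R {r}" using isolated r Q by blast
        have "r \<in> topspace R" using r UR by (auto simp: F_def)
        then have "openin R (topspace R - {r})"
          using H by (simp add: closedin_Hausdorff_singleton openin_diff)
        then show False
          using connectedinD[OF Q(2) o, of "topspace R - {r}"] r \<open>r \<notin> {x}\<close> Q openin_subset[OF Q(1)] by blast
      qed
    qed
    then show "\<exists>U. openin R U \<and> x \<in> U \<and> U \<inter> F \<subseteq> {x}" using Q by blast
  qed
  then show ?thesis by (simp add: F_def)
qed

section \<open>Points and open sets of the Reeb space\<close>

lemma Reeb_proj_eq:
  assumes "x \<in> topspace X"
  shows "Reeb_proj X c x = connected_component_of_set (subtopology X (level_set X c (c x))) x"
proof -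
  have "y = c x" if "connected_component_of (subtopology X (level_set X c y)) x z" for y z
    using that by (simp add: connected_component_of_equiv level_set_def)
  then show ?thesis by (auto simp: Reeb_proj_def Reeb_rel_def)
qed

lemma Reeb_proj_in_topspace: "x \<in> topspace X \<Longrightarrow> Reeb_proj X c x \<in> topspace (Reeb_space X c)"
  by (simp add: topspace_Reeb_space Reeb_proj_def quotientI)

lemma Reeb_proj_self: "x \<in> topspace X \<Longrightarrow> x \<in> Reeb_proj X c x"
  by (simp add: Reeb_proj_eq connected_component_of_refl level_set_def)

lemma topspace_Reeb_spaceE:
  assumes "r \<in> topspace (Reeb_space X c)"
  obtains x where "x \<in> topspace X" "r = Reeb_proj X c x" "x \<in> r"
  using assms Reeb_proj_self[of _ X c] unfolding topspace_Reeb_space Reeb_proj_def quotient_def by blast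

lemma Reeb_point_member:
  assumes "r \<in> topspace (Reeb_space X c)" "x \<in> r"
  shows "x \<in> topspace X" "Reeb_proj X c x = r" "Reeb_fun c r = c x"
proof -
  obtain y where y: "y \<in> topspace X" "r = Reeb_proj X c y"
    using assms(1) by (rule topspace_Reeb_spaceE)
  then have yx: "(y, x) \<in> Reeb_rel X c" using assms by (simp add: Reeb_proj_def)
  then show x: "x \<in> topspace X" using equiv_Reeb_rel[of X c] by (auto simp: equiv_def)
  show "Reeb_proj X c x = r"
    using y yx equiv_class_eq[OF equiv_Reeb_rel yx] by (simp add: Reeb_proj_def)
  then show "Reeb_fun c r = c x" using Reeb_fun_proj[OF x] by metis
qed

lemma Reeb_point_connected: "r \<in> topspace (Reeb_space X c) \<Longrightarrow> connectedin X r"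
  by (erule topspace_Reeb_spaceE)
    (metis Reeb_proj_eq connectedin_connected_component_of connectedin_subtopology)

lemma Reeb_proj_eqI:
  assumes "connectedin X T" "\<And>t. t \<in> T \<Longrightarrow> c t = w" "x \<in> T" "y \<in> T"
  shows "Reeb_proj X c x = Reeb_proj X c y"
proof -
  have "T \<subseteq> topspace X" using assms(1) by (rule connectedin_subset_topspace)
  then have "connectedin (subtopology X (level_set X c w)) T"
    using assms by (auto simp: connectedin_subtopology level_set_def)
  then have xy: "(x, y) \<in> Reeb_rel X c"
    using assms by (auto simp: Reeb_rel_def connected_component_of_def)
  show ?thesis unfolding Reeb_proj_def by (rule equiv_class_eq[OF equiv_Reeb_rel xy])
qed

lemma Reeb_point_component:
  assumes "r \<in> topspace (Reeb_space X c)"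
  shows "r \<in> connected_components_of (subtopology X (level_set X c (Reeb_fun c r)))"
proof -
  obtain x where x: "x \<in> topspace X" "r = Reeb_proj X c x" "x \<in> r"
    using assms by (rule topspace_Reeb_spaceE)
  moreover have "Reeb_fun c r = c x" using Reeb_point_member assms x by metis
  ultimately show ?thesis
    by (simp add: Reeb_proj_eq connected_component_in_connected_components_of level_set_def)
qed

lemma closedin_level_set:
  assumes "continuous_map X euclideanreal c"
  shows "closedin X (level_set X c y)"
proof -
  have "closedin X {x \<in> topspace X. c x \<in> {y}}"
    by (rule closedin_continuous_map_preimage[OF assms]) auto
  then show ?thesis by (simp add: level_set_def)
qed

lemma closedin_Reeb_point:
  assumes "continuous_map X euclideanreal c" "r \<in> topspace (Reeb_space X c)"
  shows "closedin X r"
  using closedin_connected_components_of[OF Reeb_point_component[OF assms(2)]]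
    closedin_level_set[OF assms(1)] by (rule closedin_trans_full)

lemma Reeb_preimage:
  assumes "U \<subseteq> topspace (Reeb_space X c)"
  shows "{x \<in> topspace X. Reeb_proj X c x \<in> U} = \<Union>U"
proof (intro set_eqI iffI)
  fix x assume "x \<in> \<Union>U"
  then obtain r where "r \<in> U" "x \<in> r" by auto
  with assms show "x \<in> {x \<in> topspace X. Reeb_proj X c x \<in> U}"
    using Reeb_point_member[of r X c x] by auto
next
  fix x assume "x \<in> {x \<in> topspace X. Reeb_proj X c x \<in> U}"
  then show "x \<in> \<Union>U" using Reeb_proj_self[of x X c] by auto
qed

text \<open>
  A point of the Reeb space is a subset of \<open>X\<close>, so the preimage of \<open>U\<close> under the quotient map is
  \<open>\<Union>U\<close>.
\<close>

lemma openin_Reeb_iff: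
  "openin (Reeb_space X c) U \<longleftrightarrow> U \<subseteq> topspace (Reeb_space X c) \<and> openin X (\<Union>U)"
  unfolding openin_Reeb_space topspace_Reeb_space[symmetric] using Reeb_preimage by metis

lemma Reeb_fun_image:
  assumes "U \<subseteq> topspace (Reeb_space X c)"
  shows "Reeb_fun c ` U = c ` \<Union>U"
proof (intro set_eqI iffI)
  fix t assume "t \<in> Reeb_fun c ` U"
  then obtain r where r: "r \<in> U" "t = Reeb_fun c r" by auto
  then obtain x where "x \<in> r" using assms topspace_Reeb_spaceE by (metis subsetD)
  then show "t \<in> c ` \<Union>U" using r assms Reeb_point_member[of r X c x] by auto
next
  fix t assume "t \<in> c ` \<Union>U"
  then obtain r x where "r \<in> U" "x \<in> r" "t = c x" by auto
  then show "t \<in> Reeb_fun c ` U" using assms Reeb_point_member[of r X c x] by (metis image_eqI subsetD)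
qed

section \<open>Neighbourhoods in proper pieces\<close>

lemma proper_fun_compactin:
  assumes "proper_fun (subtopology X M) c" "M \<subseteq> topspace X" "compact K"
  shows "compactin X {x \<in> M. c x \<in> K}"
proof -
  have "compactin (subtopology X M) {x \<in> topspace (subtopology X M). c x \<in> K}"
    using assms by (simp add: proper_fun_def)
  moreover have "{x \<in> topspace (subtopology X M). c x \<in> K} = {x \<in> M. c x \<in> K}"
    using assms(2) by auto
  ultimately show ?thesis by (simp add: compactin_subtopology)
qed

text \<open>
  In a compact Hausdorff level set, components are quasi-components, so \<open>r\<close> has a neighbourhood \<open>D\<close>
  inside \<open>N\<close> that is open and closed in the level set.  Disjoint open sets of \<open>X\<close> around \<open>D\<close> and around the rest of
  the level set contain, by properness, all points with nearby value.  A component of a nearby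
  level set is connected, so it lies in one of the two sets; this makes both sets saturated after
  cutting down to nearby values.
\<close>

lemma Reeb_saturated_nbhd:
  assumes H: "Hausdorff_space X" and c: "continuous_map X euclideanreal c"
    and U: "openin (Reeb_space X c) U" and pf: "proper_fun (subtopology X (\<Union>U)) c"
    and r: "r \<in> U" and N: "openin X N" "r \<subseteq> N"
  obtains \<delta> A B where "\<delta> > 0" "openin (Reeb_space X c) A" "openin (Reeb_space X c) B"
    "A \<inter> B = {}" "r \<in> A" "A \<union> B = {s \<in> U. \<bar>Reeb_fun c s - Reeb_fun c r\<bar> < \<delta>}" "\<Union>A \<subseteq> N"
proof -
  define R where "R = Reeb_space X c"
  define M where "M = \<Union>U"
  define v where "v = Reeb_fun c r"
  define L where "L = {x \<in> M. c x \<in> {v}}"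
  define Y where "Y = subtopology X L"
  have UR: "U \<subseteq> topspace R" and oM: "openin X M"
    using U unfolding M_def R_def openin_Reeb_iff by auto
  have MX: "M \<subseteq> topspace X" using oM openin_subset by auto
  note cpt = proper_fun_compactin[OF pf[folded M_def] MX]
  have cL: "compactin X L" unfolding L_def by (rule cpt) simp
  then have LX: "L \<subseteq> topspace X" by (rule compactin_subset_topspace)
  have mem: "c x = Reeb_fun c s" if "s \<in> U" "x \<in> s" for s x
    using Reeb_point_member(3)[of s X c x] UR that by (auto simp: R_def)
  have rL: "r \<subseteq> L" using r mem by (auto simp: L_def M_def v_def)
  have "L \<subseteq> level_set X c v" using LX by (auto simp: L_def level_set_def)
  then have "Y = subtopology (subtopology X (level_set X c v)) L"
    by (simp add: Y_def subtopology_subtopology Int_absorb1)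
  then have "r \<in> connected_components_of Y"
    using connected_components_of_subtopology[OF Reeb_point_component rL] r UR
    unfolding v_def R_def by auto
  moreover have cY: "compact_space Y" unfolding Y_def using cL by (rule compact_space_subtopology)
  moreover have HY: "Hausdorff_space Y" unfolding Y_def using H by (rule Hausdorff_space_subtopology)
  ultimately have rq: "r \<in> quasi_components_of Y"
    using quasi_eq_connected_components_of by blast
  have tY: "topspace Y = L" using LX by (auto simp: Y_def)
  have "openin Y (L \<inter> N)" unfolding Y_def using N by (simp add: openin_subtopology_Int2)
  moreover have "L - N = topspace Y - L \<inter> N" using tY by auto
  ultimately have "closedin Y (L - N)" by auto
  then have "compactin Y (L - N)" using cY closedin_compact_space by blast
  moreover have "disjnt r (L - N)" using N by (auto simp: disjnt_iff)
  ultimately have "separated_between Y r (L - N)"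
    using rq separated_between_quasi_component_compact by blast
  then obtain D where D: "closedin Y D" "openin Y D" "r \<subseteq> D" "L - N \<subseteq> L - D"
    unfolding separated_between tY by auto
  have DL: "D \<subseteq> L" using D(1) closedin_subset tY by auto
  have "compactin Y D" "compactin Y (L - D)"
    using D cY closedin_compact_space closedin_diff[OF closedin_topspace D(2)] tY by auto
  then have "compactin X D" "compactin X (L - D)"
    by (auto simp: Y_def compactin_subtopology)
  then obtain P Q where PQ: "openin X P" "openin X Q" "D \<subseteq> P" "L - D \<subseteq> Q" "disjnt P Q"
    using Hausdorff_space_compact_separation[OF H, of D "L - D"] by (auto simp: disjnt_iff)
  define P' where "P' = P \<inter> (N \<inter> M)"
  define Q' where "Q' = Q \<inter> M"
  have P': "openin X P'" "D \<subseteq> P'" and Q': "openin X Q'" "L - D \<subseteq> Q'" and dPQ: "P' \<inter> Q' = {}"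
    using PQ N(1) oM D(4) DL
    by (auto simp: P'_def Q'_def disjnt_iff L_def intro!: openin_Int)
  define K where "K = {x \<in> M. c x \<in> cball v 1} - (P' \<union> Q')"
  have "compactin X K"
  proof -
    have "closedin X (topspace X - (P' \<union> Q'))" using P' Q' by auto
    then have "compactin X ({x \<in> M. c x \<in> cball v 1} \<inter> (topspace X - (P' \<union> Q')))"
      using cpt[of "cball v 1"] by (intro compact_Int_closedin) auto
    moreover have "{x \<in> M. c x \<in> cball v 1} \<inter> (topspace X - (P' \<union> Q')) = K"
      using MX by (auto simp: K_def)
    ultimately show ?thesis by simp
  qed
  then have "compact (c ` K)" using image_compactin[OF _ c] by fastforce
  then have "open (- (c ` K))" by (simp add: compact_imp_closed open_Compl)
  moreover have "v \<notin> c ` K" using P'(2) Q'(2) by (auto simp: K_def L_def)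
  ultimately obtain \<gamma> where \<gamma>: "\<gamma> > 0" "ball v \<gamma> \<subseteq> - (c ` K)"
    by (meson ComplI open_contains_ball)
  define \<delta> where "\<delta> = min \<gamma> 1"
  define T where "T = {s \<in> U. \<bar>Reeb_fun c s - v\<bar> < \<delta>}"
  define A where "A = {s \<in> T. s \<subseteq> P'}"
  define B where "B = {s \<in> T. s \<subseteq> Q'}"
  have TU: "T \<subseteq> U" by (auto simp: T_def)
  have split: "s \<subseteq> P' \<or> s \<subseteq> Q'" if s: "s \<in> T" for s
  proof -
    have "s \<subseteq> P' \<union> Q'"
    proof
      fix x assume x: "x \<in> s"
      have "x \<in> M" using x s by (auto simp: T_def M_def)
      moreover have "\<bar>c x - v\<bar> < \<delta>" using mem[OF _ x] s by (auto simp: T_def)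
      then have "c x \<in> ball v \<gamma>" "c x \<in> cball v 1" by (auto simp: \<delta>_def dist_real_def)
      ultimately show "x \<in> P' \<union> Q'" using \<gamma>(2) by (auto simp: K_def)
    qed
    moreover have "connectedin X s" using s TU UR Reeb_point_connected unfolding R_def by (metis subsetD)
    ultimately show ?thesis
      using connectedinD[OF _ P'(1) Q'(1), of s] dPQ by blast
  qed
  have oT: "openin X {x \<in> M. c x \<in> ball v \<delta>}"
  proof -
    have "openin X (M \<inter> {x \<in> topspace X. c x \<in> ball v \<delta>})"
      by (intro openin_Int oM openin_continuous_map_preimage[OF c]) auto
    moreover have "M \<inter> {x \<in> topspace X. c x \<in> ball v \<delta>} = {x \<in> M. c x \<in> ball v \<delta>}" using MX by auto
    ultimately show ?thesis by simp
  qed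
  have inT: "s \<in> T \<longleftrightarrow> c x \<in> ball v \<delta>" if "s \<in> U" "x \<in> s" for s x
    using mem[OF that] that by (auto simp: T_def dist_real_def)
  have "\<Union>A = P' \<inter> {x \<in> M. c x \<in> ball v \<delta>}"
    using split inT TU dPQ unfolding A_def M_def by blast
  then have oA: "openin R A"
    using UR TU oT P' unfolding R_def openin_Reeb_iff by (auto simp: A_def intro: openin_Int)
  have "\<Union>B = Q' \<inter> {x \<in> M. c x \<in> ball v \<delta>}"
    using split inT TU dPQ unfolding B_def M_def by blast
  then have oB: "openin R B"
    using UR TU oT Q' unfolding R_def openin_Reeb_iff by (auto simp: B_def intro: openin_Int)
  have ne: "s \<noteq> {}" if "s \<in> U" for s
    using that UR topspace_Reeb_spaceE unfolding R_def by (metis empty_iff subsetD)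
  show thesis
  proof (rule that[OF _ oA[unfolded R_def] oB[unfolded R_def]])
    show "0 < \<delta>" using \<gamma> by (simp add: \<delta>_def)
    show "A \<inter> B = {}" using ne dPQ TU unfolding A_def B_def by blast
    show "r \<in> A" using r D(3) P'(2) \<gamma> by (auto simp: A_def T_def v_def \<delta>_def)
    show "A \<union> B = {s \<in> U. \<bar>Reeb_fun c s - Reeb_fun c r\<bar> < \<delta>}"
      using split by (auto simp: A_def B_def T_def v_def)
    show "\<Union>A \<subseteq> N" by (auto simp: A_def P'_def)
  qed
qed

text \<open>
  The saturated neighbourhood is applied with \<open>N\<close> the complement of the closed set \<open>s\<close>.  The
  covering by \<open>A\<close> and \<open>B\<close> is recorded because it says more than separation: the fibre is totally
  disconnected, uniformly for nearby values.
\<close>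

lemma Reeb_proper_fibre_separation:
  assumes H: "Hausdorff_space X" and c: "continuous_map X euclideanreal c"
    and U: "openin (Reeb_space X c) U" and pf: "proper_fun (subtopology X (\<Union>U)) c"
    and rs: "r \<in> U" "s \<in> U" "r \<noteq> s" "Reeb_fun c r = v" "Reeb_fun c s = v"
  shows "\<exists>\<delta>>0. \<exists>A B. openin (Reeb_space X c) A \<and> openin (Reeb_space X c) B \<and> A \<inter> B = {} \<and> r \<in> A \<and> s \<in> B \<and>
    {u \<in> U. \<bar>Reeb_fun c u - v\<bar> < \<delta>} \<subseteq> A \<union> B"
proof -
  have R: "r \<in> topspace (Reeb_space X c)" "s \<in> topspace (Reeb_space X c)"
    using U openin_subset rs by blast+
  have N: "openin X (topspace X - s)" using closedin_Reeb_point[OF c R(2)] by auto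
  have rN: "r \<subseteq> topspace X - s"
    using Reeb_point_member(1,2)[OF R(1)] Reeb_point_member(2)[OF R(2)] rs(3) by (metis DiffI subsetI)
  obtain \<delta> A B where *: "\<delta> > 0" "openin (Reeb_space X c) A" "openin (Reeb_space X c) B"
    "A \<inter> B = {}" "r \<in> A" "A \<union> B = {s \<in> U. \<bar>Reeb_fun c s - Reeb_fun c r\<bar> < \<delta>}" "\<Union>A \<subseteq> topspace X - s"
    by (rule Reeb_saturated_nbhd[OF H c U pf rs(1) N rN])
  have "s \<noteq> {}" using R(2) topspace_Reeb_spaceE by (metis empty_iff)
  then have "s \<notin> A" using *(7) by blast
  moreover have "s \<in> A \<union> B" using *(1,6) rs by auto
  ultimately show ?thesis using * rs(4) by (intro exI[of _ \<delta>] conjI exI[of _ A] exI[of _ B]) auto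
qed

section \<open>Regular components of proper level sets\<close>

text \<open>
  Flow boxes of a submersion have this property.  Connected levels and openness are the part of
  the local product structure that is visible in the Reeb space.
\<close>

definition level_box :: "'a topology \<Rightarrow> ('a \<Rightarrow> real) \<Rightarrow> 'a set \<Rightarrow> bool" where
  "level_box X c B \<longleftrightarrow> openin X B \<and> (\<forall>G. openin X G \<and> G \<subseteq> B \<longrightarrow> open (c ` G)) \<and>
     (\<forall>w. connectedin X {x \<in> B. c x = w})"

definition level_regular :: "'a topology \<Rightarrow> ('a \<Rightarrow> real) \<Rightarrow> 'a \<Rightarrow> bool" where
  "level_regular X c p \<longleftrightarrow> (\<forall>G. openin X G \<and> p \<in> G \<longrightarrow> (\<exists>B. p \<in> B \<and> B \<subseteq> G \<and> level_box X c B))"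

lemma level_regular_open_image:
  assumes "openin X G" "\<And>p. p \<in> G \<Longrightarrow> level_regular X c p"
  shows "open (c ` G)"
proof (subst open_subopen, intro ballI)
  fix t assume "t \<in> c ` G"
  then obtain p where p: "p \<in> G" "t = c p" by auto
  then obtain B where "p \<in> B" "B \<subseteq> G" "level_box X c B"
    using assms unfolding level_regular_def by meson
  then show "\<exists>T. open T \<and> t \<in> T \<and> T \<subseteq> c ` G"
    using p unfolding level_box_def by (intro exI[of _ "c ` B"]) auto
qed

text \<open>
  The compact component \<open>r\<close> is covered by finitely many boxes.  Two boxes that meet on \<open>r\<close> still meet
  on every nearby level, because the function is open there.  As \<open>r\<close> is connected, the pieces of a
  nearby level in the boxes form one connected set.  All components of nearby levels close to
  \<open>r\<close> lie in these boxes, so there is only one for each value.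
\<close>

lemma regular_at_Reeb_proper:
  assumes H: "Hausdorff_space X" and c: "continuous_map X euclideanreal c"
    and U: "openin (Reeb_space X c) U" and pf: "proper_fun (subtopology X (\<Union>U)) c"
    and r: "r \<in> U" and reg: "\<And>p. p \<in> r \<Longrightarrow> level_regular X c p"
  shows "regular_at (Reeb_space X c) (Reeb_fun c) r"
proof -
  define R where "R = Reeb_space X c"
  define v where "v = Reeb_fun c r"
  have UR: "U \<subseteq> topspace R" and oM: "openin X (\<Union>U)"
    using U unfolding R_def openin_Reeb_iff by auto
  have rR: "r \<in> topspace (Reeb_space X c)" using r UR by (auto simp: R_def)
  have cr: "c x = v" if "x \<in> r" for x using Reeb_point_member(3)[OF rR that] by (simp add: v_def)
  have "compactin X r"
  proof (rule closed_compactin)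
    show "compactin X {x \<in> \<Union>U. c x \<in> {v}}"
      by (rule proper_fun_compactin[OF pf]) (use oM openin_subset in auto)
    show "r \<subseteq> {x \<in> \<Union>U. c x \<in> {v}}" using r cr by auto
    show "closedin X r" by (rule closedin_Reeb_point[OF c rR])
  qed
  moreover have "r \<subseteq> \<Union>{B. level_box X c B \<and> B \<inter> r \<noteq> {} \<and> B \<subseteq> \<Union>U}"
  proof
    fix p assume p: "p \<in> r"
    then obtain B where "p \<in> B" "B \<subseteq> \<Union>U" "level_box X c B"
      using reg[OF p] oM r unfolding level_regular_def by blast
    then show "p \<in> \<Union>{B. level_box X c B \<and> B \<inter> r \<noteq> {} \<and> B \<subseteq> \<Union>U}" using p by blast
  qed
  ultimately obtain \<B> where B: "finite \<B>" "\<B> \<subseteq> {B. level_box X c B \<and> B \<inter> r \<noteq> {} \<and> B \<subseteq> \<Union>U}" "r \<subseteq> \<Union>\<B>"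
    using compactinD[of X r "{B. level_box X c B \<and> B \<inter> r \<noteq> {} \<and> B \<subseteq> \<Union>U}"]
    by (auto simp: level_box_def)
  have box: "level_box X c B" "openin X B" "B \<inter> r \<noteq> {}" if "B \<in> \<B>" for B
    using B(2) that by (auto simp: level_box_def)
  define T where "T = (\<Inter>B\<in>\<B>. \<Inter>B'\<in>\<B>. if B \<inter> B' \<inter> r = {} then UNIV else c ` (B \<inter> B'))"
  have "open (c ` (B \<inter> B'))" if "B \<in> \<B>" "B' \<in> \<B>" for B B'
    using box[OF that(1)] box[OF that(2)] unfolding level_box_def by auto
  then have oT: "open T" unfolding T_def using B(1) by (intro open_INT ballI) auto
  have vT: "v \<in> T" unfolding T_def using cr by (auto split: if_splits)
  define N where "N = \<Union>\<B>"
  have conn: "connectedin X {x \<in> N. c x = w}" if w: "w \<in> T" for w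
  proof -
    define Y where "Y = subtopology X {x \<in> N. c x = w}"
    have meet: "\<exists>z\<in>B \<inter> B'. c z = w" if "B \<in> \<B>" "B' \<in> \<B>" "B \<inter> B' \<inter> r \<noteq> {}" for B B'
    proof -
      have "w \<in> (if B \<inter> B' \<inter> r = {} then UNIV else c ` (B \<inter> B'))"
        using w that(1,2) unfolding T_def by blast
      then show ?thesis using that(3) by auto
    qed
    have NX: "N \<subseteq> topspace X" unfolding N_def using box openin_subset by blast
    have same: "connected_component_of Y y z" if "B \<in> \<B>" "y \<in> B" "z \<in> B" "c y = w" "c z = w" for B y z
    proof -
      have "connectedin X {x \<in> B. c x = w}" using box[OF that(1)] by (auto simp: level_box_def)
      then have "connectedin Y {x \<in> B. c x = w}"
        using that(1) by (auto simp: Y_def N_def connectedin_subtopology)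
      then show ?thesis using that unfolding connected_component_of_def by blast
    qed
    have "connected_component_of Y x y" if x: "x \<in> N" "c x = w" and y: "y \<in> N" "c y = w" for x y
    proof -
      \<comment> \<open>\<open>P B\<close>: the part of the level in \<open>B\<close> lies in the component of \<open>x\<close>; this spreads along boxes that meet on \<open>r\<close>.\<close>
      define P where "P B \<longleftrightarrow> (\<forall>z\<in>B. c z = w \<longrightarrow> connected_component_of Y x z)" for B
      obtain B1 B2 where B1: "B1 \<in> \<B>" "x \<in> B1" and B2: "B2 \<in> \<B>" "y \<in> B2"
        using x y by (auto simp: N_def)
      have "P B1" unfolding P_def using same[OF B1] x by auto
      have step: "P B'" if BB: "B \<in> \<B>" "B' \<in> \<B>" "B \<inter> B' \<inter> r \<noteq> {}" and PB: "P B" for B B'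
      proof -
        obtain z where z: "z \<in> B" "z \<in> B'" "c z = w" using meet[OF BB] by auto
        then have "connected_component_of Y x z" using PB by (auto simp: P_def)
        then show ?thesis unfolding P_def using same[OF BB(2) z(2) _ z(3)] connected_component_of_trans by metis
      qed
      have "P B2"
      proof (rule ccontr)
        assume "\<not> P B2"
        let ?E = "\<Union>{B \<in> \<B>. P B}" and ?F = "\<Union>{B \<in> \<B>. \<not> P B}"
        have "openin X ?E" "openin X ?F" using box by auto
        moreover have "r \<subseteq> ?E \<union> ?F" using B(3) by auto
        moreover have "?E \<inter> ?F \<inter> r = {}" using step by blast
        moreover have "?E \<inter> r \<noteq> {}" using box(3)[OF B1(1)] B1 \<open>P B1\<close> by auto
        moreover have "?F \<inter> r \<noteq> {}" using box(3)[OF B2(1)] B2 \<open>\<not> P B2\<close> by auto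
        ultimately show False
          using connectedinD[OF Reeb_point_connected[OF rR]] by blast
      qed
      then show ?thesis using B2 y by (auto simp: P_def)
    qed
    then have "connected_space Y"
      using NX by (auto simp: connected_space_iff_connected_component Y_def)
    then show ?thesis using NX by (auto simp: connectedin_def Y_def)
  qed
  have "openin X N" unfolding N_def using box by auto
  moreover have "r \<subseteq> N" using B(3) by (simp add: N_def)
  ultimately obtain \<delta> A A' where A: "openin R A" "r \<in> A" "\<Union>A \<subseteq> N"
    "A \<union> A' = {s \<in> U. \<bar>Reeb_fun c s - Reeb_fun c r\<bar> < \<delta>}"
    unfolding R_def by (rule Reeb_saturated_nbhd[OF H c U pf r])
  define C where "C = A \<inter> {s \<in> topspace R. Reeb_fun c s \<in> T}"
  have oC: "openin R C" unfolding C_def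
    using A(1) openin_continuous_map_preimage[OF continuous_map_Reeb_fun[OF c], of T] oT
    unfolding R_def by (intro openin_Int) auto
  have "inj_on (Reeb_fun c) C"
  proof (rule inj_onI)
    fix s t assume s: "s \<in> C" and t: "t \<in> C" and eq: "Reeb_fun c s = Reeb_fun c t"
    have sR: "s \<in> topspace (Reeb_space X c)" and tR: "t \<in> topspace (Reeb_space X c)"
      using s t by (auto simp: C_def R_def)
    obtain x y where x: "x \<in> s" and y: "y \<in> t" using sR tR topspace_Reeb_spaceE by metis
    have "c x = Reeb_fun c s" "c y = Reeb_fun c s"
      using Reeb_point_member(3)[OF sR x] Reeb_point_member(3)[OF tR y] eq by auto
    moreover have "x \<in> N" "y \<in> N" using A(3) s t x y by (auto simp: C_def)
    moreover have "Reeb_fun c s \<in> T" using s by (simp add: C_def)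
    ultimately have "Reeb_proj X c x = Reeb_proj X c y"
      by (intro Reeb_proj_eqI[OF conn[of "Reeb_fun c s"], where w = "Reeb_fun c s"]) simp_all
    then show "s = t" using Reeb_point_member(2)[OF sR x] Reeb_point_member(2)[OF tR y] by simp
  qed
  moreover have "open (Reeb_fun c ` G)" if G: "openin R G" "G \<subseteq> C" for G
  proof -
    have GR: "G \<subseteq> topspace (Reeb_space X c)" and oG: "openin X (\<Union>G)"
      using G unfolding R_def openin_Reeb_iff by auto
    have "\<Union>G \<subseteq> N" using G A(3) by (auto simp: C_def)
    then have "c ` \<Union>G = (\<Union>B\<in>\<B>. c ` (\<Union>G \<inter> B))" unfolding N_def by blast
    moreover have "open (c ` (\<Union>G \<inter> B))" if "B \<in> \<B>" for B
      using box[OF that] oG unfolding level_box_def by (metis inf_le2 openin_Int)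
    ultimately have "open (c ` \<Union>G)" by auto
    then show ?thesis unfolding Reeb_fun_image[OF GR] .
  qed
  moreover have "r \<in> C" using A(2) rR vT by (auto simp: C_def R_def v_def)
  ultimately show ?thesis
    using oC unfolding regular_at_def real_chart_def R_def by blast
qed

section \<open>Level sets near noncritical points\<close>

lemma Euclidean_space_box:
  assumes P: "openin (Euclidean_space n) P" and x: "x \<in> P"
  obtains \<delta> where "\<delta> > 0"
    "\<And>y. y \<in> topspace (Euclidean_space n) \<Longrightarrow> (\<And>j. j < n \<Longrightarrow> \<bar>y j - x j\<bar> < \<delta>) \<Longrightarrow> y \<in> P"
proof -
  obtain T where T: "openin (powertop_real UNIV) T" "P = T \<inter> {x. \<forall>i\<ge>n. x i = 0}"
    using P by (auto simp: Euclidean_space_def openin_subtopology)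
  then obtain U where U: "\<And>j. openin euclideanreal (U j)" "x \<in> Pi\<^sub>E UNIV U" "Pi\<^sub>E UNIV U \<subseteq> T"
    using x unfolding openin_product_topology_alt by (metis IntD1 UNIV_I)
  have "\<exists>\<delta>>0. ball (x j) \<delta> \<subseteq> U j" for j
    using U(1,2) open_contains_ball[of "U j"] by (auto simp: PiE_iff)
  then obtain d where d: "\<And>j. d j > 0" "\<And>j. ball (x j) (d j) \<subseteq> U j" by metis
  define \<delta> where "\<delta> = Min (insert 1 (d ` {..<n}))"
  have "\<delta> > 0" unfolding \<delta>_def using d(1) by (subst Min_gr_iff) auto
  moreover have "y \<in> P" if y: "y \<in> topspace (Euclidean_space n)" "\<And>j. j < n \<Longrightarrow> \<bar>y j - x j\<bar> < \<delta>" for y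
  proof -
    have "y j \<in> U j" for j
    proof (cases "j < n")
      case True
      then have "\<delta> \<le> d j" unfolding \<delta>_def by (intro Min_le) auto
      then have "y j \<in> ball (x j) (d j)" using y(2)[OF True] by (auto simp: dist_real_def)
      then show ?thesis using d(2)[of j] by blast
    next
      case False
      then have "y j = x j" using y(1) x T(2) by (auto simp: topspace_Euclidean_space)
      then show ?thesis using U(2) by (auto simp: PiE_iff)
    qed
    then have "y \<in> Pi\<^sub>E UNIV U" by auto
    then show ?thesis using U(3) y(1) T(2) by (auto simp: topspace_Euclidean_space)
  qed
  ultimately show thesis by (rule that)
qed

lemma fun_upd_in_Euclidean_space:
  "i < n \<Longrightarrow> y \<in> topspace (Euclidean_space n) \<Longrightarrow> y(i := t) \<in> topspace (Euclidean_space n)"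
  by (auto simp: topspace_Euclidean_space)

lemma continuous_map_Euclidean_fun_upd:
  assumes "i < n" and g: "continuous_map (subtopology (Euclidean_space n) S) euclideanreal g"
  shows "continuous_map (subtopology (Euclidean_space n) S) (Euclidean_space n) (\<lambda>y. y(i := g y))"
proof -
  have "continuous_map (subtopology (Euclidean_space n) S) euclideanreal (\<lambda>y. (y(i := g y)) k)" for k
  proof (cases "k = i")
    case False
    have "continuous_map (powertop_real UNIV) euclideanreal (\<lambda>y. y k)"
      by (rule continuous_map_product_projection) simp
    then show ?thesis
      using False by (simp add: Euclidean_space_def continuous_map_from_subtopology)
  qed (use g in simp)
  then have "continuous_map (subtopology (Euclidean_space n) S) (powertop_real UNIV) (\<lambda>y. y(i := g y))"
    by (simp add: continuous_map_componentwise_UNIV)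
  moreover have "(\<lambda>y. y(i := g y)) \<in> topspace (subtopology (Euclidean_space n) S) \<rightarrow> {x. \<forall>i\<ge>n. x i = 0}"
    using assms(1) by (auto simp: topspace_Euclidean_space)
  ultimately show ?thesis
    unfolding Euclidean_space_def[of n] continuous_map_in_subtopology
    by (simp add: image_subset_iff_funcset)
qed

lemma connectedin_Euclidean_slab:
  assumes x: "x \<in> topspace (Euclidean_space n)" and i: "i < n" and \<eta>: "\<eta> > 0"
  shows "connectedin (Euclidean_space n)
    {y \<in> topspace (Euclidean_space n). \<forall>j<n. j \<noteq> i \<longrightarrow> \<bar>y j - x j\<bar> < \<eta>}" (is "connectedin _ ?K")
proof -
  define S where "S j = (if j < n then if j = i then UNIV else {x j - \<eta><..<x j + \<eta>} else {0})" for j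
  have K: "?K = Pi\<^sub>E UNIV S"
  proof (intro set_eqI iffI)
    fix y assume "y \<in> ?K"
    then have "j < n \<Longrightarrow> j \<noteq> i \<Longrightarrow> \<bar>y j - x j\<bar> < \<eta>" "j \<ge> n \<Longrightarrow> y j = 0" for j
      by (auto simp: topspace_Euclidean_space)
    then have "y j \<in> S j" for j
      unfolding S_def abs_less_iff by (smt (verit) UNIV_I greaterThanLessThan_iff not_le singletonI)
    then show "y \<in> Pi\<^sub>E UNIV S" by auto
  next
    fix y assume "y \<in> Pi\<^sub>E UNIV S"
    then have "y j \<in> S j" for j by auto
    then have "j < n \<Longrightarrow> j \<noteq> i \<Longrightarrow> \<bar>y j - x j\<bar> < \<eta>" "j \<ge> n \<Longrightarrow> y j = 0" for j
      unfolding S_def abs_less_iff by (smt (verit) greaterThanLessThan_iff not_le singletonD)+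
    then show "y \<in> ?K" by (auto simp: topspace_Euclidean_space)
  qed
  have "connectedin euclideanreal (S j)" for j by (simp add: S_def)
  then have "connectedin (powertop_real UNIV) (Pi\<^sub>E UNIV S)" by (simp add: connectedin_PiE)
  moreover have "?K \<subseteq> {x. \<forall>i\<ge>n. x i = 0}" by (auto simp: topspace_Euclidean_space)
  ultimately show ?thesis
    unfolding Euclidean_space_def[of n] connectedin_subtopology K[unfolded Euclidean_space_def[of n]]
    by (simp add: Euclidean_space_def)
qed

lemma increasing_line:
  assumes der: "\<And>y. y \<in> P \<Longrightarrow> \<exists>D>0. ((\<lambda>t. f (y(i := t))) has_real_derivative D) (at (y i))"
    and seg: "\<And>t. \<alpha> \<le> t \<Longrightarrow> t \<le> \<beta> \<Longrightarrow> y(i := t) \<in> P"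
  shows "continuous_on {\<alpha>..\<beta>} (\<lambda>t. f (y(i := t)))"
    and "\<alpha> \<le> s \<Longrightarrow> s < t \<Longrightarrow> t \<le> \<beta> \<Longrightarrow> f (y(i := s)) < f (y(i := t))"
proof -
  have d: "\<exists>D. ((\<lambda>t. f (y(i := t))) has_real_derivative D) (at t) \<and> D > 0" if "\<alpha> \<le> t" "t \<le> \<beta>" for t
    using der[OF seg[OF that]] by auto
  then show "continuous_on {\<alpha>..\<beta>} (\<lambda>t. f (y(i := t)))"
    by (intro continuous_at_imp_continuous_on ballI) (metis DERIV_isCont atLeastAtMost_iff)
  show "f (y(i := s)) < f (y(i := t))" if "\<alpha> \<le> s" "s < t" "t \<le> \<beta>"
    by (rule DERIV_pos_imp_increasing[of s t "\<lambda>t. f (y(i := t))"]) (use d that in auto)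
qed

lemma increasing_open_image:
  assumes i: "i < n" and G: "openin (Euclidean_space n) G"
    and der: "\<And>y. y \<in> G \<Longrightarrow> \<exists>D>0. ((\<lambda>t. f (y(i := t))) has_real_derivative D) (at (y i))"
  shows "open (f ` G)"
proof (subst open_subopen, intro ballI)
  fix v assume "v \<in> f ` G"
  then obtain y where y: "y \<in> G" "v = f y" by auto
  obtain \<delta> where \<delta>: "\<delta> > 0" and
    box: "\<And>z. z \<in> topspace (Euclidean_space n) \<Longrightarrow> (\<And>j. j < n \<Longrightarrow> \<bar>z j - y j\<bar> < \<delta>) \<Longrightarrow> z \<in> G"
    using Euclidean_space_box[OF G y(1)] by blast
  have yE: "y \<in> topspace (Euclidean_space n)" using G y openin_subset by blast
  define \<alpha> where "\<alpha> = y i - \<delta> / 2"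
  define \<beta> where "\<beta> = y i + \<delta> / 2"
  have ab: "\<alpha> < y i" "y i < \<beta>" using \<delta> by (auto simp: \<alpha>_def \<beta>_def)
  have seg: "y(i := t) \<in> G" if t: "\<alpha> \<le> t" "t \<le> \<beta>" for t
  proof (rule box[OF fun_upd_in_Euclidean_space[OF i yE]])
    fix j show "\<bar>(y(i := t)) j - y j\<bar> < \<delta>"
      using t \<delta> by (auto simp: \<alpha>_def \<beta>_def abs_less_iff field_simps)
  qed
  note line = increasing_line[of G f i \<alpha> \<beta> y, OF der seg]
  let ?T = "{f (y(i := \<alpha>))<..<f (y(i := \<beta>))}"
  have "v \<in> ?T" using line(2)[of \<alpha> "y i"] line(2)[of "y i" \<beta>] ab y(2) by auto
  moreover have "?T \<subseteq> f ` G"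
  proof
    fix w assume "w \<in> ?T"
    then obtain t where "\<alpha> \<le> t" "t \<le> \<beta>" "f (y(i := t)) = w"
      using IVT'[OF _ _ _ line(1), of w] ab by auto
    then show "w \<in> f ` G" using seg by blast
  qed
  ultimately show "\<exists>T. open T \<and> v \<in> T \<and> T \<subseteq> f ` G" by (intro exI[of _ ?T]) auto
qed

text \<open>
  On a product box around \<open>x\<close>, thin in the directions other than \<open>i\<close>, every value near \<open>f x\<close> is taken
  exactly once on each line in direction \<open>i\<close>.  So a level set is the graph of a function \<open>g\<close> over a
  product of intervals.  By monotonicity, \<open>g y > s\<close> means \<open>f (y(i := s)) < w\<close>, which is an open
  condition on \<open>y\<close>; hence \<open>g\<close> is continuous and the graph is connected.
\<close>

lemma increasing_level_box:
  assumes i: "i < n" and P: "openin (Euclidean_space n) P"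
    and f: "continuous_map (subtopology (Euclidean_space n) P) euclideanreal f"
    and der: "\<And>y. y \<in> P \<Longrightarrow> \<exists>D>0. ((\<lambda>t. f (y(i := t))) has_real_derivative D) (at (y i))"
    and x: "x \<in> P"
  shows "\<exists>B. x \<in> B \<and> B \<subseteq> P \<and> level_box (Euclidean_space n) f B"
proof -
  define E where "E = Euclidean_space n"
  have PE: "P \<subseteq> topspace E" using P openin_subset by (auto simp: E_def)
  have xE: "x \<in> topspace E" using x PE by auto
  have upd: "y(i := t) \<in> topspace E" if "y \<in> topspace E" for y t
    using fun_upd_in_Euclidean_space[OF i] that by (simp add: E_def)
  obtain \<delta> where \<delta>: "\<delta> > 0" and
    box: "\<And>y. y \<in> topspace E \<Longrightarrow> (\<And>j. j < n \<Longrightarrow> \<bar>y j - x j\<bar> < \<delta>) \<Longrightarrow> y \<in> P"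
    using Euclidean_space_box[OF P x] unfolding E_def by blast
  define \<alpha> where "\<alpha> = x i - \<delta> / 2"
  define \<beta> where "\<beta> = x i + \<delta> / 2"
  have ab: "\<alpha> < x i" "x i < \<beta>" "\<alpha> < \<beta>" using \<delta> by (auto simp: \<alpha>_def \<beta>_def)
  have inside: "y(i := t) \<in> P" if y: "y \<in> topspace E" "\<And>j. j < n \<Longrightarrow> j \<noteq> i \<Longrightarrow> \<bar>y j - x j\<bar> < \<delta>"
    and t: "\<alpha> \<le> t" "t \<le> \<beta>" for y t
  proof (rule box[OF upd[OF y(1)]])
    fix j assume "j < n"
    then show "\<bar>(y(i := t)) j - x j\<bar> < \<delta>"
      using y(2)[of j] t \<delta> by (auto simp: \<alpha>_def \<beta>_def abs_less_iff field_simps)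
  qed
  have xin: "x(i := t) \<in> P" if "\<alpha> \<le> t" "t \<le> \<beta>" for t
    by (rule inside[OF xE _ that]) (use \<delta> in auto)
  have lv: "f (x(i := \<alpha>)) < f x" and vu: "f x < f (x(i := \<beta>))"
    using increasing_line(2)[of P f i \<alpha> \<beta> x \<alpha> "x i", OF der xin]
      increasing_line(2)[of P f i \<alpha> \<beta> x "x i" \<beta>, OF der xin] ab by auto
  obtain l u where l: "f (x(i := \<alpha>)) < l" "l < f x" and u: "f x < u" "u < f (x(i := \<beta>))"
    using dense[OF lv] dense[OF vu] by blast
  have oPT: "openin E {y \<in> P. f y \<in> T}" if T: "open T" for T
  proof -
    have "openin (subtopology E P) {y \<in> topspace (subtopology E P). f y \<in> T}"
      by (rule openin_continuous_map_preimage[OF f[folded E_def]]) (use T in auto)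
    moreover have "{y \<in> topspace (subtopology E P). f y \<in> T} = {y \<in> P. f y \<in> T}" using PE by auto
    ultimately show ?thesis using P unfolding E_def by (metis openin_trans_full)
  qed
  have preim: "openin E {y \<in> topspace E. y(i := t) \<in> P \<and> f (y(i := t)) \<in> T}" if T: "open T" for t T
  proof -
    note oPT[OF T]
    moreover have "continuous_map E E (\<lambda>y. y(i := t))"
      using continuous_map_Euclidean_fun_upd[OF i, of UNIV "\<lambda>_. t"] by (simp add: E_def)
    ultimately have "openin E {y \<in> topspace E. y(i := t) \<in> {y \<in> P. f y \<in> T}}"
      by (rule openin_continuous_map_preimage[rotated])
    then show ?thesis by simp
  qed
  have "openin E ({y \<in> topspace E. y(i := \<alpha>) \<in> P \<and> f (y(i := \<alpha>)) \<in> {..<l}} \<inter>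
      {y \<in> topspace E. y(i := \<beta>) \<in> P \<and> f (y(i := \<beta>)) \<in> {u<..}})" (is "openin E ?W")
    by (intro openin_Int preim) auto
  moreover have "x \<in> ?W" using xE xin[of \<alpha>] xin[of \<beta>] ab l u by auto
  ultimately obtain \<eta>' where \<eta>': "\<eta>' > 0" and
    W: "\<And>y. y \<in> topspace E \<Longrightarrow> (\<And>j. j < n \<Longrightarrow> \<bar>y j - x j\<bar> < \<eta>') \<Longrightarrow> y \<in> ?W"
    using Euclidean_space_box[of n ?W x] unfolding E_def by blast
  define \<eta> where "\<eta> = min \<eta>' \<delta>"
  have \<eta>: "\<eta> > 0" using \<eta>' \<delta> by (simp add: \<eta>_def)
  \<comment> \<open>\<open>K\<close> restricts the coordinates \<open>j \<noteq> i\<close> only, so it is a union of full lines in direction \<open>i\<close>.\<close>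
  define K where "K = {y \<in> topspace E. \<forall>j<n. j \<noteq> i \<longrightarrow> \<bar>y j - x j\<bar> < \<eta>}"
  define B where "B = {y \<in> K. \<alpha> < y i \<and> y i < \<beta> \<and> l < f y \<and> f y < u}"
  have KE: "K \<subseteq> topspace E" by (auto simp: K_def)
  have KP: "y(i := t) \<in> P" if "y \<in> K" "\<alpha> \<le> t" "t \<le> \<beta>" for y t
    by (rule inside) (use that in \<open>auto simp: K_def \<eta>_def\<close>)
  have Kends: "f (y(i := \<alpha>)) < l" "u < f (y(i := \<beta>))" if y: "y \<in> K" for y
  proof -
    have "y(i := x i) \<in> ?W"
      by (rule W[OF upd]) (use y \<eta>' in \<open>auto simp: K_def \<eta>_def\<close>)
    then show "f (y(i := \<alpha>)) < l" "u < f (y(i := \<beta>))" by auto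
  qed
  have cont_line: "continuous_on {\<alpha>..\<beta>} (\<lambda>t. f (y(i := t)))" if "y \<in> K" for y
    by (rule increasing_line(1)[of P f i \<alpha> \<beta> y, OF der KP[OF that]])
  have incr_line: "f (y(i := s)) < f (y(i := t))" if "y \<in> K" "\<alpha> \<le> s" "s < t" "t \<le> \<beta>" for y s t
    using increasing_line(2)[of P f i \<alpha> \<beta> y s t, OF der KP[OF that(1)]] that(2-4) by simp
  have BP: "B \<subseteq> P"
  proof
    fix y assume y: "y \<in> B"
    then have "y(i := y i) \<in> P"
      by (intro KP) (auto simp: B_def)
    then show "y \<in> P" by simp
  qed
  have oB: "openin E B"
  proof -
    have proj: "openin E {y \<in> topspace E. y j \<in> T}" if "open T" for j and T :: "real set"
    proof (rule openin_continuous_map_preimage)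
      show "continuous_map E euclideanreal (\<lambda>y. y j)"
        unfolding E_def Euclidean_space_def
        by (intro continuous_map_from_subtopology continuous_map_product_projection) simp
    qed (use that in auto)
    have slab: "openin E (topspace E \<inter> (\<Inter>j\<in>{j. j < n \<and> j \<noteq> i}. {y \<in> topspace E. y j \<in> ball (x j) \<eta>}))"
    proof (cases "{j. j < n \<and> j \<noteq> i} = {}")
      case False
      then show ?thesis by (intro openin_Int openin_topspace openin_INT2 proj) auto
    qed (simp only: INT_empty, simp)
    have "openin E (topspace E \<inter> (\<Inter>j\<in>{j. j < n \<and> j \<noteq> i}. {y \<in> topspace E. y j \<in> ball (x j) \<eta>})
        \<inter> {y \<in> topspace E. y i \<in> {\<alpha><..<\<beta>}} \<inter> {y \<in> P. f y \<in> {l<..<u}})"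
      by (intro openin_Int[OF openin_Int[OF slab]] proj oPT) auto
    moreover have "\<dots> = B"
      using BP by (auto simp: B_def K_def dist_real_def abs_minus_commute)
    ultimately show ?thesis by (simp only:)
  qed
  have "connectedin E {y \<in> B. f y = w}" for w
  proof (cases "l < w \<and> w < u")
    case False
    then have "{y \<in> B. f y = w} = {}" by (auto simp: B_def)
    then show ?thesis by (simp only: connectedin_empty)
  next
    case True
    have "\<exists>t. \<alpha> < t \<and> t < \<beta> \<and> f (y(i := t)) = w" if y: "y \<in> K" for y
    proof -
      obtain t where t: "\<alpha> \<le> t" "t \<le> \<beta>" "f (y(i := t)) = w"
        using IVT'[OF _ _ _ cont_line[OF y], of w] Kends[OF y] True ab by auto
      moreover have "t \<noteq> \<alpha>" "t \<noteq> \<beta>" using t(3) Kends[OF y] True by auto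
      ultimately show ?thesis by (intro exI[of _ t]) auto
    qed
    then obtain g where g: "\<And>y. y \<in> K \<Longrightarrow> \<alpha> < g y \<and> g y < \<beta> \<and> f (y(i := g y)) = w" by metis
    have above: "g y > s \<longleftrightarrow> f (y(i := s)) < w" if y: "y \<in> K" and s: "\<alpha> \<le> s" "s \<le> \<beta>" for y s
      using incr_line[OF y, of s "g y"] incr_line[OF y, of "g y" s] g[OF y] s
      by (cases s "g y" rule: linorder_cases) auto
    have below: "g y < s \<longleftrightarrow> w < f (y(i := s))" if y: "y \<in> K" and s: "\<alpha> \<le> s" "s \<le> \<beta>" for y s
      using incr_line[OF y, of s "g y"] incr_line[OF y, of "g y" s] g[OF y] s
      by (cases s "g y" rule: linorder_cases) auto
    have K_open: "openin (subtopology E K) {y \<in> K. f (y(i := s)) \<in> T}"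
      if "\<alpha> \<le> s" "s \<le> \<beta>" "open T" for s T
    proof -
      have "{y \<in> K. f (y(i := s)) \<in> T} = {y \<in> topspace E. y(i := s) \<in> P \<and> f (y(i := s)) \<in> T} \<inter> K"
        using KP[OF _ that(1,2)] KE by auto
      then show ?thesis using preim[OF that(3), of s] by (auto simp: openin_subtopology)
    qed
    have tK: "topspace (subtopology E K) = K" using KE by auto
    have gcont: "continuous_map (subtopology E K) euclideanreal g"
      unfolding continuous_map_upper_lower_semicontinuous_lt tK
    proof (intro conjI allI)
      fix s
      consider "s < \<alpha>" | "\<alpha> \<le> s" "s \<le> \<beta>" | "\<beta> < s" by linarith
      then show "openin (subtopology E K) {y \<in> K. s < g y}"
      proof cases
        case 1
        then have "{y \<in> K. s < g y} = topspace (subtopology E K)" using g tK by force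
        then show ?thesis by (metis openin_topspace)
      next
        case 2
        then show ?thesis using K_open[OF 2, of "{..<w}"] above by (simp cong: conj_cong)
      next
        case 3
        then have "{y \<in> K. s < g y} = {}" using g by force
        then show ?thesis by (metis openin_empty)
      qed
      consider "s < \<alpha>" | "\<alpha> \<le> s" "s \<le> \<beta>" | "\<beta> < s" by linarith
      then show "openin (subtopology E K) {y \<in> K. g y < s}"
      proof cases
        case 3
        then have "{y \<in> K. g y < s} = topspace (subtopology E K)" using g tK by force
        then show ?thesis by (metis openin_topspace)
      next
        case 2
        then show ?thesis using K_open[OF 2, of "{w<..}"] below by (simp cong: conj_cong)
      next
        case 1
        then have "{y \<in> K. g y < s} = {}" using g by force
        then show ?thesis by (metis openin_empty)
      qed
    qed
    have "continuous_map (subtopology E K) E (\<lambda>y. y(i := g y))"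
      using continuous_map_Euclidean_fun_upd[OF i] gcont by (simp add: E_def)
    moreover have "connectedin (subtopology E K) K"
      using connectedin_Euclidean_slab[OF xE[unfolded E_def] i \<eta>]
      by (simp add: connectedin_subtopology K_def E_def)
    ultimately have "connectedin E ((\<lambda>y. y(i := g y)) ` K)"
      by (rule connectedin_continuous_map_image)
    moreover have "(\<lambda>y. y(i := g y)) ` K = {y \<in> B. f y = w}"
    proof (intro set_eqI iffI)
      fix z assume "z \<in> (\<lambda>y. y(i := g y)) ` K"
      then obtain y where y: "y \<in> K" "z = y(i := g y)" by auto
      then show "z \<in> {y \<in> B. f y = w}"
        using g[OF y(1)] True upd by (auto simp: B_def K_def)
    next
      fix z assume z: "z \<in> {y \<in> B. f y = w}"
      then have zK: "z \<in> K" and zi: "\<alpha> \<le> z i" "z i \<le> \<beta>"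
        by (auto simp: B_def)
      have "g z = z i"
        using above[OF zK zi] below[OF zK zi] z by auto
      then show "z \<in> (\<lambda>y. y(i := g y)) ` K"
        using zK by (intro image_eqI[of _ _ z]) auto
    qed
    ultimately show ?thesis by simp
  qed
  moreover have "open (f ` G)" if "openin E G" "G \<subseteq> B" for G
    by (rule increasing_open_image[OF i]) (use that der BP in \<open>auto simp: E_def\<close>)
  moreover have "x \<in> B" using xE \<eta> ab l u by (auto simp: B_def K_def)
  ultimately show ?thesis
    using oB BP unfolding level_box_def E_def by blast
qed

lemma level_box_uminus: "level_box X (\<lambda>x. - f x) B \<longleftrightarrow> level_box X f B"
proof -
  have *: "level_box X (\<lambda>x. - f x) B" if "level_box X f B" for f
  proof -
    have "{x \<in> B. - f x = w} = {x \<in> B. f x = - w}" for w by auto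
    moreover have "open ((\<lambda>x. - f x) ` G)" if "open (f ` G)" for G
      using open_negations[OF that] by (simp add: image_image)
    ultimately show ?thesis using that by (simp add: level_box_def)
  qed
  then show ?thesis using *[of f] *[of "\<lambda>x. - f x"] by auto
qed

lemma level_regular_of_partial_deriv:
  assumes V: "openin (Euclidean_space n) V" and f: "Ck_on n (Suc 0) V f"
    and x: "x \<in> V" and i: "i < n" and nz: "partial_deriv i f x \<noteq> 0"
  shows "level_regular (subtopology (Euclidean_space n) V) f x"
  unfolding level_regular_def
proof (intro allI impI)
  let ?E = "Euclidean_space n"
  fix G assume G: "openin (subtopology ?E V) G \<and> x \<in> G"
  then have GV: "G \<subseteq> V" by (auto simp: openin_subtopology)
  have VE: "V \<subseteq> topspace ?E" using V openin_subset by auto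
  have fc: "continuous_map (subtopology ?E V) euclideanreal f"
    and pc: "continuous_map (subtopology ?E V) euclideanreal (partial_deriv i f)"
    and df: "\<And>y. y \<in> V \<Longrightarrow> (\<lambda>t. f (y(i := t))) differentiable at (y i)"
    using f i by auto
  define s where "s = sgn (partial_deriv i f x)"
  define P where "P = G \<inter> {y \<in> V. s * partial_deriv i f y \<in> {0<..}}"
  have s: "s = 1 \<or> s = -1" using nz by (auto simp: s_def sgn_real_def)
  have "continuous_map (subtopology ?E V) euclideanreal (\<lambda>y. s * partial_deriv i f y)"
    by (intro continuous_intros pc)
  from openin_continuous_map_preimage[OF this, of "{0<..}"]
  have "openin (subtopology ?E V) {y \<in> V. s * partial_deriv i f y \<in> {0<..}}"
    using VE by (simp add: Int_absorb1)
  then have oPV: "openin (subtopology ?E V) P" using G unfolding P_def by (intro openin_Int) auto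
  then have oP: "openin ?E P" using V openin_trans_full by blast
  have xP: "x \<in> P" using x nz G s by (auto simp: P_def s_def sgn_real_def split: if_splits)
  have PV: "P \<subseteq> V" by (auto simp: P_def)
  have "\<exists>B. x \<in> B \<and> B \<subseteq> P \<and> level_box ?E (\<lambda>y. s * f y) B"
  proof (rule increasing_level_box[OF i oP _ _ xP])
    have "continuous_map (subtopology (subtopology ?E V) P) euclideanreal (\<lambda>y. s * f y)"
      by (intro continuous_map_from_subtopology continuous_intros fc)
    then show "continuous_map (subtopology ?E P) euclideanreal (\<lambda>y. s * f y)"
      using PV by (simp add: subtopology_subtopology Int_absorb1)
    fix y assume y: "y \<in> P"
    then have "((\<lambda>t. f (y(i := t))) has_real_derivative partial_deriv i f y) (at (y i))"
      using df[of y] PV DERIV_deriv_iff_real_differentiable unfolding partial_deriv_def by blast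
    then have "((\<lambda>t. s * f (y(i := t))) has_real_derivative s * partial_deriv i f y) (at (y i))"
      by (rule DERIV_cmult)
    then show "\<exists>D>0. ((\<lambda>t. s * f (y(i := t))) has_real_derivative D) (at (y i))"
      using y by (intro exI[of _ "s * partial_deriv i f y"]) (auto simp: P_def)
  qed
  then obtain B where B: "x \<in> B" "B \<subseteq> P" "level_box ?E (\<lambda>y. s * f y) B" by auto
  have "level_box ?E f B" using B(3) s by (auto simp: level_box_uminus)
  then have "level_box (subtopology ?E V) f B"
    using V B(2) PV openin_trans_full[of ?E V]
    by (auto simp: level_box_def connectedin_subtopology openin_open_subtopology)
  then show "\<exists>B. x \<in> B \<and> B \<subseteq> G \<and> level_box (subtopology ?E V) f B"
    using B by (auto simp: P_def)
qed

lemma level_regular_homeomorphic: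
  assumes U: "openin X U" and \<phi>: "homeomorphic_map (subtopology X U) Y \<phi>" and p: "p \<in> U"
    and fc: "\<And>x. x \<in> U \<Longrightarrow> f (\<phi> x) = c x" and reg: "level_regular Y f (\<phi> p)"
  shows "level_regular X c p"
  unfolding level_regular_def
proof (intro allI impI)
  fix G assume G: "openin X G \<and> p \<in> G"
  have UX: "U \<subseteq> topspace X" using U openin_subset by auto
  obtain \<psi> where hm: "homeomorphic_maps (subtopology X U) Y \<phi> \<psi>"
    using \<phi> by (auto simp: homeomorphic_map_maps)
  then have \<psi>: "homeomorphic_map Y (subtopology X U) \<psi>"
    and \<psi>\<phi>: "\<And>x. x \<in> U \<Longrightarrow> \<psi> (\<phi> x) = x" and \<phi>\<psi>: "\<And>y. y \<in> topspace Y \<Longrightarrow> \<phi> (\<psi> y) = y"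
    using UX by (auto simp: homeomorphic_maps_map)
  have \<phi>open: "openin Y (\<phi> ` A)" if "openin X A" "A \<subseteq> U" for A
    using homeomorphic_imp_open_map[OF \<phi>] that U by (auto simp: open_map_def openin_open_subtopology)
  have "openin Y (\<phi> ` (G \<inter> U))" using G U by (intro \<phi>open) auto
  then obtain B where B: "\<phi> p \<in> B" "B \<subseteq> \<phi> ` (G \<inter> U)" "level_box Y f B"
    using reg G p unfolding level_regular_def by blast
  have oB: "openin Y B" using B by (simp add: level_box_def)
  have BY: "B \<subseteq> topspace Y" using oB openin_subset by auto
  have cont: "continuous_map Y X \<psi>"
    using homeomorphic_imp_continuous_map[OF \<psi>] by (simp add: continuous_map_in_subtopology)
  have \<psi>B: "\<psi> ` B \<subseteq> G \<inter> U" using B(2) \<psi>\<phi> by force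
  have c\<psi>: "c (\<psi> y) = f y" if "y \<in> B" for y
  proof -
    have "\<psi> y \<in> U" "\<phi> (\<psi> y) = y" using \<psi>B that \<phi>\<psi> BY by auto
    then show ?thesis using fc[of "\<psi> y"] by simp
  qed
  have "openin (subtopology X U) (\<psi> ` B)"
    using homeomorphic_imp_open_map[OF \<psi>] oB by (auto simp: open_map_def)
  then have "openin X (\<psi> ` B)" using U openin_trans_full by blast
  moreover have "connectedin X {x \<in> \<psi> ` B. c x = w}" for w
  proof -
    have "connectedin Y {y \<in> B. f y = w}" using B(3) by (simp add: level_box_def)
    then have "connectedin X (\<psi> ` {y \<in> B. f y = w})" by (rule connectedin_continuous_map_image[OF cont])
    moreover have "\<psi> ` {y \<in> B. f y = w} = {x \<in> \<psi> ` B. c x = w}" using c\<psi> by auto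
    ultimately show ?thesis by simp
  qed
  moreover have "open (c ` A)" if A: "openin X A" "A \<subseteq> \<psi> ` B" for A
  proof -
    have AU: "A \<subseteq> U" using A \<psi>B by auto
    have "\<phi> ` A \<subseteq> B" using A(2) \<phi>\<psi> BY by force
    moreover have "openin Y (\<phi> ` A)" using \<phi>open A(1) AU by blast
    ultimately have "open (f ` \<phi> ` A)" using B(3) by (simp add: level_box_def)
    moreover have "f ` \<phi> ` A = c ` A" using fc AU by (auto simp: image_image subset_iff intro!: image_cong)
    ultimately show ?thesis by simp
  qed
  moreover have "p \<in> \<psi> ` B" using B(1) \<psi>\<phi>[OF p] by (metis image_eqI)
  ultimately show "\<exists>B. p \<in> B \<and> B \<subseteq> G \<and> level_box X c B"
    using \<psi>B unfolding level_box_def by (intro exI[of _ "\<psi> ` B"]) auto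
qed

lemma smooth_manifold_chart:
  assumes "smooth_manifold n X \<A>" "(U, \<phi>) \<in> \<A>"
  shows "openin X U" "openin (Euclidean_space n) (\<phi> ` U)" "inj_on \<phi> U"
    "homeomorphic_map (subtopology X U) (subtopology (Euclidean_space n) (\<phi> ` U)) \<phi>"
proof -
  show U: "openin X U" and "openin (Euclidean_space n) (\<phi> ` U)" and
    h: "homeomorphic_map (subtopology X U) (subtopology (Euclidean_space n) (\<phi> ` U)) \<phi>"
    using assms unfolding smooth_manifold_def by fastforce+
  show "inj_on \<phi> U"
    using homeomorphic_imp_injective_map[OF h] openin_subset[OF U] by (simp add: Int_absorb1)
qed

lemma smooth_manifold_cover:
  assumes "smooth_manifold n X \<A>" "p \<in> topspace X"
  obtains U \<phi> where "(U, \<phi>) \<in> \<A>" "p \<in> U"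
  using assms unfolding smooth_manifold_def by blast

lemma level_regular_if_not_critical:
  assumes man: "smooth_manifold n X \<A>" and sm: "smooth_function n \<A> c"
    and p: "p \<in> topspace X" "p \<notin> critical_set n \<A> c"
  shows "level_regular X c p"
proof -
  have "p \<in> (\<Union>(U, \<phi>)\<in>\<A>. U)" using smooth_manifold_cover[OF man p(1)] by blast
  then obtain U \<phi> i where U: "(U, \<phi>) \<in> \<A>" "p \<in> U" and i: "i < n" 
    and nz: "partial_deriv i (c \<circ> inv_into U \<phi>) (\<phi> p) \<noteq> 0"
    using p(2) unfolding critical_set_def by fastforce
  note ch = smooth_manifold_chart[OF man U(1)]
  have "smooth_fun_on n (\<phi> ` U) (c \<circ> inv_into U \<phi>)"
    using sm U(1) unfolding smooth_function_def by fastforce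
  then have "Ck_on n (Suc 0) (\<phi> ` U) (c \<circ> inv_into U \<phi>)" unfolding smooth_fun_on_def by blast
  then have "level_regular (subtopology (Euclidean_space n) (\<phi> ` U)) (c \<circ> inv_into U \<phi>) (\<phi> p)"
    using level_regular_of_partial_deriv[OF ch(2) _ _ i nz] U(2) by blast
  then show ?thesis
    by (rule level_regular_homeomorphic[OF ch(1,4) U(2), rotated]) (use ch(3) in auto)
qed

lemma smooth_function_continuous:
  assumes man: "smooth_manifold n X \<A>" and sm: "smooth_function n \<A> c"
  shows "continuous_map X euclideanreal c"
  unfolding continuous_map_def
proof (intro conjI allI impI)
  fix T :: "real set" assume T: "openin euclideanreal T"
  show "openin X {x \<in> topspace X. c x \<in> T}"
  proof (subst openin_subopen, intro ballI)
    fix p assume p: "p \<in> {x \<in> topspace X. c x \<in> T}"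
    then obtain U \<phi> where U: "(U, \<phi>) \<in> \<A>" "p \<in> U" using smooth_manifold_cover[OF man] by blast
    note ch = smooth_manifold_chart[OF man U(1)]
    have "smooth_fun_on n (\<phi> ` U) (c \<circ> inv_into U \<phi>)"
      using sm U(1) unfolding smooth_function_def by fastforce
    then have "Ck_on n 0 (\<phi> ` U) (c \<circ> inv_into U \<phi>)" unfolding smooth_fun_on_def by blast
    then have "continuous_map (subtopology X U) euclideanreal ((c \<circ> inv_into U \<phi>) \<circ> \<phi>)"
      by (intro continuous_map_compose[OF homeomorphic_imp_continuous_map[OF ch(4)]]) simp
    then have "openin (subtopology X U) {x \<in> topspace (subtopology X U). ((c \<circ> inv_into U \<phi>) \<circ> \<phi>) x \<in> T}"
      using T by (rule openin_continuous_map_preimage)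
    moreover have "{x \<in> topspace (subtopology X U). ((c \<circ> inv_into U \<phi>) \<circ> \<phi>) x \<in> T} = {x \<in> U. c x \<in> T}"
      using ch(3) openin_subset[OF ch(1)] by auto
    ultimately have "openin X {x \<in> U. c x \<in> T}" using ch(1) openin_trans_full by metis
    then show "\<exists>G. openin X G \<and> p \<in> G \<and> G \<subseteq> {x \<in> topspace X. c x \<in> T}"
      using U p openin_subset[OF ch(1)] by (intro exI[of _ "{x \<in> U. c x \<in> T}"]) auto
  qed
qed auto

lemma smooth_manifold_locally_connected:
  assumes man: "smooth_manifold n X \<A>"
  shows "locally_connected_space X"
  unfolding locally_connected_space
proof (intro allI impI)
  fix G p assume G: "openin X G \<and> p \<in> G"
  then have "p \<in> topspace X" using openin_subset by blast
  then obtain U \<phi> where U: "(U, \<phi>) \<in> \<A>" "p \<in> U" by (rule smooth_manifold_cover[OF man])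
  note ch = smooth_manifold_chart[OF man U(1)]
  have "locally_connected_space (subtopology (Euclidean_space n) (\<phi> ` U))"
    using locally_path_connected_Euclidean_space[THEN locally_path_connected_imp_locally_connected_space] ch(2)
    by (rule locally_connected_space_open_subset)
  then have "locally_connected_space (subtopology X U)"
    using homeomorphic_locally_connected_space[OF homeomorphic_map_imp_homeomorphic_space[OF ch(4)]] by blast
  moreover have "openin (subtopology X U) (G \<inter> U)" using G by (simp add: openin_subtopology_Int)
  moreover have "p \<in> G \<inter> U" using G U(2) by simp
  ultimately obtain V where "openin (subtopology X U) V" "connectedin (subtopology X U) V" "p \<in> V" "V \<subseteq> G \<inter> U"
    by (rule locally_connected_spaceE)
  then show "\<exists>V. openin X V \<and> connectedin X V \<and> p \<in> V \<and> V \<subseteq> G"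
    using openin_trans_full[OF _ ch(1)] by (intro exI[of _ V]) (auto simp: connectedin_subtopology)
qed

text \<open>
  The inverse of a restricted chart agrees with the inverse of the chart on an open set of the
  model space, which contains short segments in the coordinate directions; so the partial
  derivatives agree.
\<close>

lemma critical_set_restrict_atlas:
  assumes man: "smooth_manifold n X \<A>" and Z: "openin X Z"
  shows "critical_set n (restrict_atlas \<A> Z) c = critical_set n \<A> c \<inter> Z"
proof -
  have eq: "partial_deriv i (c \<circ> inv_into (U \<inter> Z) \<phi>) (\<phi> p) = partial_deriv i (c \<circ> inv_into U \<phi>) (\<phi> p)"
    if U: "(U, \<phi>) \<in> \<A>" and p: "p \<in> U" "p \<in> Z" and i: "i < n" for U \<phi> p i
  proof -
    note ch = smooth_manifold_chart[OF man U]
    have "openin (subtopology X U) (U \<inter> Z)" using Z by (simp add: openin_subtopology_Int2)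
    then have "openin (subtopology (Euclidean_space n) (\<phi> ` U)) (\<phi> ` (U \<inter> Z))"
      using homeomorphic_imp_open_map[OF ch(4)] by (auto simp: open_map_def)
    then have oP: "openin (Euclidean_space n) (\<phi> ` (U \<inter> Z))" using ch(2) openin_trans_full by blast
    have pP: "\<phi> p \<in> \<phi> ` (U \<inter> Z)" using p by auto
    obtain \<delta> where \<delta>: "\<delta> > 0" and box: "\<And>y. y \<in> topspace (Euclidean_space n) \<Longrightarrow>
        (\<And>j. j < n \<Longrightarrow> \<bar>y j - \<phi> p j\<bar> < \<delta>) \<Longrightarrow> y \<in> \<phi> ` (U \<inter> Z)"
      using Euclidean_space_box[OF oP pP] by blast
    have "(c \<circ> inv_into (U \<inter> Z) \<phi>) ((\<phi> p)(i := t)) = (c \<circ> inv_into U \<phi>) ((\<phi> p)(i := t))"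
      if t: "t \<in> ball (\<phi> p i) \<delta>" for t
    proof -
      have "\<phi> p \<in> topspace (Euclidean_space n)" using oP pP openin_subset by blast
      then have "(\<phi> p)(i := t) \<in> \<phi> ` (U \<inter> Z)"
        by (intro box fun_upd_in_Euclidean_space i) (use t \<delta> in \<open>auto simp: dist_real_def\<close>)
      then obtain u where "u \<in> U" "u \<in> Z" "(\<phi> p)(i := t) = \<phi> u" by auto
      then show ?thesis using ch(3) by (simp add: inv_into_f_f inj_on_Int)
    qed
    then have "eventually (\<lambda>t. (c \<circ> inv_into (U \<inter> Z) \<phi>) ((\<phi> p)(i := t)) = (c \<circ> inv_into U \<phi>) ((\<phi> p)(i := t)))
        (nhds (\<phi> p i))"
      using \<delta> by (intro eventually_nhds_in_open[THEN eventually_mono, of "ball (\<phi> p i) \<delta>"]) auto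
    then show ?thesis unfolding partial_deriv_def by (rule deriv_cong_ev) simp
  qed
  show ?thesis
    unfolding critical_set_def restrict_atlas_def using eq by (auto simp: split_beta)
qed

section \<open>The Reeb space of a smooth function\<close>

text \<open>
  Properness refers to compact sets in the whole line.  Near a point \<open>x\<close> outside \<open>M\<close>, the function
  takes values close to \<open>c x\<close>, and the part of \<open>M\<close> with such values is compact, hence closed.
\<close>

lemma proper_fun_imp_closedin:
  assumes H: "Hausdorff_space X" and c: "continuous_map X euclideanreal c"
    and M: "openin X M" and pf: "proper_fun (subtopology X M) c"
  shows "closedin X M"
proof -
  have MX: "M \<subseteq> topspace X" using M openin_subset by auto
  have "\<exists>G. openin X G \<and> x \<in> G \<and> G \<subseteq> topspace X - M" if x: "x \<in> topspace X - M" for x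
  proof -
    define K where "K = {y \<in> M. c y \<in> cball (c x) 1}"
    have "compactin X K" unfolding K_def by (rule proper_fun_compactin[OF pf MX]) simp
    then have "closedin X K" by (rule compactin_imp_closedin[OF H])
    moreover have "openin X {y \<in> topspace X. c y \<in> ball (c x) 1}"
      by (rule openin_continuous_map_preimage[OF c]) auto
    ultimately have "openin X ({y \<in> topspace X. c y \<in> ball (c x) 1} - K)" by (intro openin_diff)
    then show ?thesis
      using x by (intro exI[of _ "{y \<in> topspace X. c y \<in> ball (c x) 1} - K"]) (auto simp: K_def)
  qed
  then have "openin X (topspace X - M)" by (subst openin_subopen) auto
  then show ?thesis using MX by (simp add: closedin_def)
qed

lemma proper_fun_imp_closedin_Reeb:
  assumes H: "Hausdorff_space X" and c: "continuous_map X euclideanreal c"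
    and U: "openin (Reeb_space X c) U" and pf: "proper_fun (subtopology X (\<Union>U)) c"
  shows "closedin (Reeb_space X c) U"
proof -
  have UR: "U \<subseteq> topspace (Reeb_space X c)" and M: "openin X (\<Union>U)"
    using U unfolding openin_Reeb_iff by auto
  have "{x \<in> topspace X. Reeb_proj X c x \<in> U} = \<Union>U" using UR by (rule Reeb_preimage)
  then show ?thesis
    using proper_fun_imp_closedin[OF H c M pf] quotient_map_Reeb_proj[of X c] UR
    unfolding quotient_map_closedin by metis
qed

lemma closed_discrete_inI:
  assumes ZR: "Z \<subseteq> topspace R"
    and iso: "\<And>x. x \<in> topspace R \<Longrightarrow> \<exists>U. openin R U \<and> x \<in> U \<and> U \<inter> Z \<subseteq> {x}"
  shows "closed_discrete_in R Z"
proof -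
  have "\<exists>U. openin R U \<and> x \<in> U \<and> U \<subseteq> topspace R - Z" if x: "x \<in> topspace R - Z" for x
  proof -
    obtain U where "openin R U" "x \<in> U" "U \<inter> Z \<subseteq> {x}" using iso x by blast
    then show ?thesis using x openin_subset by (intro exI[of _ U]) blast
  qed
  then have "openin R (topspace R - Z)" by (subst openin_subopen) auto
  then have "closedin R Z" using ZR by (simp add: closedin_def)
  moreover have "openin (subtopology R Z) {x}" if x: "x \<in> Z" for x
  proof -
    obtain U where "openin R U" "x \<in> U" "U \<inter> Z \<subseteq> {x}" using iso x ZR by blast
    moreover from this x have "{x} = U \<inter> Z" by auto
    ultimately show ?thesis by (metis openin_subtopology)
  qed
  then have "subtopology R Z = discrete_topology Z"
    using ZR discrete_topology_unique[of Z "subtopology R Z"] by (simp add: Int_absorb1)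
  ultimately show ?thesis by (simp add: closed_discrete_in_def)
qed

lemma closed_discrete_in_subset:
  assumes "closed_discrete_in R Z" "W \<subseteq> Z"
  shows "closed_discrete_in R W"
proof -
  have Z: "closedin R Z" "subtopology R Z = discrete_topology Z"
    using assms by (auto simp: closed_discrete_in_def)
  have "closedin R W" using closedin_trans_full[of R Z W] Z assms(2) by simp
  moreover have "subtopology R W = subtopology (subtopology R Z) W"
    using assms(2) by (simp add: subtopology_subtopology Int_absorb1)
  ultimately show ?thesis
    using Z assms(2) by (simp add: closed_discrete_in_def subtopology_discrete_topology Int_absorb1)
qed

lemma closed_discrete_Int_compact_finite:
  assumes "closed_discrete_in R Z" "compactin R K"
  shows "finite (K \<inter> Z)"
proof -
  have Z: "closedin R Z" "subtopology R Z = discrete_topology Z"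
    using assms by (auto simp: closed_discrete_in_def)
  have "compactin R (K \<inter> Z)" using assms(2) Z(1) by (rule compact_Int_closedin)
  then have "compactin (subtopology R Z) (K \<inter> Z)" by (simp add: compactin_subtopology)
  then show ?thesis by (simp add: Z(2) compactin_discrete_topology)
qed

theorem mainTheorem1:
  fixes n :: nat and X :: "'a topology" and \<A> :: "'a chart set" and c :: "'a \<Rightarrow> real"
    and \<Lambda>P :: "'i set" and UP :: "'i \<Rightarrow> 'a set set"
    and \<Lambda>NP :: "'j set" and UNP :: "'j \<Rightarrow> 'a set set"
  defines "R \<equiv> Reeb_space X c"
    and "q \<equiv> Reeb_proj X c"
    and "cbar \<equiv> Reeb_fun c"
  defines "pre \<equiv> \<lambda>U. {x \<in> topspace X. q x \<in> U}"
    and "V \<equiv> topspace R - ((\<Union>l\<in>\<Lambda>P. UP l) \<union> (\<Union>l\<in>\<Lambda>NP. UNP l))"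
  defines "W \<equiv> {r \<in> topspace R. cbar r \<in> cbar ` V}"
  assumes manifold: "smooth_manifold n X \<A>"
    and smooth: "smooth_function n \<A> c"
    and nonproper: "\<not> proper_fun X c"
    and nonconstant: "\<not> c constant_on topspace X"
    and UP: "\<And>l. l \<in> \<Lambda>P \<Longrightarrow> UP l \<noteq> {} \<and> openin R (UP l)"
    and UNP: "\<And>l. l \<in> \<Lambda>NP \<Longrightarrow> UNP l \<noteq> {} \<and> openin R (UNP l) \<and> connectedin R (UNP l)"
    and disj_P: "disjoint_family_on UP \<Lambda>P"
    and disj_NP: "disjoint_family_on UNP \<Lambda>NP"
    and disj_P_NP: "\<And>l m. l \<in> \<Lambda>P \<Longrightarrow> m \<in> \<Lambda>NP \<Longrightarrow> UP l \<inter> UNP m = {}"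
    and proper_P: "\<And>l. l \<in> \<Lambda>P \<Longrightarrow> proper_fun (subtopology X (pre (UP l))) c"
    and regular_NP: "\<And>l. l \<in> \<Lambda>NP \<Longrightarrow> critical_set n (restrict_atlas \<A> (pre (UNP l))) c = {}"
    and levels_NP: "\<And>l y. l \<in> \<Lambda>NP \<Longrightarrow> y \<in> c ` pre (UNP l) \<Longrightarrow>
        \<not> compactin X (level_set (subtopology X (pre (UNP l))) c y) \<and>
        connectedin X (level_set (subtopology X (pre (UNP l))) c y)"
  shows "(Hausdorff_space R \<longleftrightarrow>
            (\<forall>v \<in> cbar ` V. \<forall>r\<in>topspace R. \<forall>s\<in>topspace R.
               cbar r = v \<and> cbar s = v \<and> r \<noteq> s \<longrightarrow>
               (\<exists>A B. openin R A \<and> openin R B \<and> r \<in> A \<and> s \<in> B \<and> A \<inter> B = {})))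
       \<and> (Hausdorff_space R \<and> (\<forall>l\<in>\<Lambda>P. compactin R (R closure_of UP l)) \<longrightarrow>
            ((\<exists>Z \<E>. CW_complex_1 R Z \<E> \<and> Z = W \<union> q ` critical_set n \<A> c \<and>
                     closed_discrete_in R (W \<union> q ` critical_set n \<A> c))
             \<longleftrightarrow>
             closed_discrete_in R W \<and>
             (\<forall>l\<in>\<Lambda>P. finite (c ` critical_set n (restrict_atlas \<A> (pre (UP l))) c))))"
proof -
  define S where "S = critical_set n \<A> c"
  have HX: "Hausdorff_space X" using manifold by (simp add: smooth_manifold_def)
  have cc: "continuous_map X euclideanreal c"
    using manifold smooth by (rule smooth_function_continuous)
  have cbar: "continuous_map R euclideanreal cbar"
    unfolding R_def cbar_def using cc by (rule continuous_map_Reeb_fun)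
  have lcR: "locally_connected_space R"
    unfolding R_def using smooth_manifold_locally_connected[OF manifold] quotient_map_Reeb_proj
    by (rule locally_connected_space_quotient_map_image)
  have SX: "S \<subseteq> topspace X"
    unfolding S_def critical_set_def using manifold unfolding smooth_manifold_def by auto
  have oP: "openin R (UP l)" and PR: "UP l \<subseteq> topspace R" if "l \<in> \<Lambda>P" for l
    using UP that openin_subset by auto
  have oN: "openin R (UNP l)" and NR: "UNP l \<subseteq> topspace R" if "l \<in> \<Lambda>NP" for l
    using UNP that openin_subset by auto
  have pre_eq: "pre U = \<Union>U" if "U \<subseteq> topspace R" for U
    using Reeb_preimage that unfolding pre_def q_def R_def by blast
  have prP: "proper_fun (subtopology X (\<Union>(UP l))) c" if "l \<in> \<Lambda>P" for l
    using proper_P[OF that] pre_eq[OF PR[OF that]] by simp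
  have clP: "closedin R (UP l)" if "l \<in> \<Lambda>P" for l
    using proper_fun_imp_closedin_Reeb[OF HX cc _ prP[OF that]] oP[OF that] by (simp add: R_def)
  have Un: "openin X (\<Union>U)" if "openin R U" for U
    using that unfolding R_def openin_Reeb_iff by simp
  have critP: "critical_set n (restrict_atlas \<A> (pre (UP l))) c = S \<inter> \<Union>(UP l)" if "l \<in> \<Lambda>P" for l
    using critical_set_restrict_atlas[OF manifold Un[OF oP[OF that]]] pre_eq[OF PR[OF that]]
    by (simp add: S_def)
  have critN: "S \<inter> \<Union>(UNP l) = {}" if "l \<in> \<Lambda>NP" for l
    using critical_set_restrict_atlas[OF manifold Un[OF oN[OF that]], of c] pre_eq[OF NR[OF that]]
      regular_NP[OF that] by (simp add: S_def)
  have mem: "x \<in> topspace X" "q x = r" "cbar r = c x" if "r \<in> topspace R" "x \<in> r" for r x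
    using Reeb_point_member[of r X c x] that by (auto simp: R_def q_def cbar_def)
  have ne: "\<exists>x. x \<in> r" if "r \<in> topspace R" for r
    using that topspace_Reeb_spaceE unfolding R_def by metis
  have qS: "q ` S \<subseteq> topspace R" "r \<in> topspace R \<Longrightarrow> r \<inter> S \<noteq> {} \<Longrightarrow> r \<in> q ` S"
    "r \<in> q ` S \<Longrightarrow> r \<inter> S \<noteq> {}" for r
  proof -
    show "q ` S \<subseteq> topspace R"
      using SX Reeb_proj_in_topspace[of _ X c] by (auto simp: q_def R_def)
    show "r \<in> q ` S" if "r \<in> topspace R" "r \<inter> S \<noteq> {}"
    proof -
      obtain x where "x \<in> r" "x \<in> S" using \<open>r \<inter> S \<noteq> {}\<close> by auto
      then show ?thesis using mem(2)[of r x] that(1) by (intro image_eqI[of _ _ x]) auto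
    qed
    show "r \<inter> S \<noteq> {}" if "r \<in> q ` S"
      using that SX Reeb_proj_self[of _ X c] by (force simp: q_def)
  qed
  have lreg: "level_regular X c p" if "p \<in> topspace X" "p \<notin> S" for p
    using level_regular_if_not_critical[OF manifold smooth] that by (simp add: S_def)
  have injN: "inj_on cbar (UNP l)" if l: "l \<in> \<Lambda>NP" for l
  proof (rule inj_onI)
    fix r s assume r: "r \<in> UNP l" and s: "s \<in> UNP l" and eq: "cbar r = cbar s"
    have R: "r \<in> topspace R" "s \<in> topspace R" using r s NR[OF l] by auto
    obtain x y where x: "x \<in> r" and y: "y \<in> s" using ne R by metis
    let ?L = "level_set (subtopology X (pre (UNP l))) c (cbar r)"
    have U: "pre (UNP l) = \<Union>(UNP l)" using pre_eq[OF NR[OF l]] .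
    have "c x = cbar r" "c y = cbar r" using mem(3)[OF R(1) x] mem(3)[OF R(2) y] eq by auto
    then have xy: "x \<in> ?L" "y \<in> ?L"
      using x y r s mem(1)[OF R(1) x] mem(1)[OF R(2) y] by (auto simp: level_set_def U)
    have "x \<in> pre (UNP l)" using x r U by auto
    then have "cbar r \<in> c ` pre (UNP l)" using mem(3)[OF R(1) x] by (metis image_eqI)
    then have "connectedin X ?L" using levels_NP[OF l] by blast
    then have "Reeb_proj X c x = Reeb_proj X c y"
      by (rule Reeb_proj_eqI[where w = "cbar r"]) (use xy in \<open>auto simp: level_set_def\<close>)
    then show "r = s" using mem(2)[OF R(1) x] mem(2)[OF R(2) y] by (simp add: q_def)
  qed
  have regN: "regular_at R cbar r" if l: "l \<in> \<Lambda>NP" and r: "r \<in> UNP l" for l r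
  proof -
    have "open (cbar ` G)" if G: "openin R G" "G \<subseteq> UNP l" for G
    proof -
      have GR: "G \<subseteq> topspace (Reeb_space X c)" using G openin_subset by (auto simp: R_def)
      have "open (c ` \<Union>G)"
      proof (rule level_regular_open_image[OF Un[OF G(1)]])
        fix p assume "p \<in> \<Union>G"
        then show "level_regular X c p"
          using critN[OF l] G(2) openin_subset[OF Un[OF G(1)]] by (intro lreg) auto
      qed
      then show ?thesis using Reeb_fun_image[OF GR] by (simp add: cbar_def)
    qed
    then show ?thesis using oN[OF l] injN[OF l] r unfolding regular_at_def real_chart_def by blast
  qed
  have regP: "regular_at R cbar r" if l: "l \<in> \<Lambda>P" and r: "r \<in> UP l" "r \<inter> S = {}" for l r
  proof -
    have "r \<in> topspace R" using r PR[OF l] by auto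
    then have "level_regular X c p" if "p \<in> r" for p
      using mem(1)[of r p] r(2) that by (intro lreg) auto
    then show ?thesis
      using regular_at_Reeb_proper[OF HX cc _ prP[OF l] r(1)] oP[OF l] by (simp add: R_def cbar_def)
  qed
  have sepP: "\<exists>\<delta>>0. \<exists>A B. openin R A \<and> openin R B \<and> A \<inter> B = {} \<and> r \<in> A \<and> s \<in> B \<and>
      {u \<in> UP l. \<bar>cbar u - v\<bar> < \<delta>} \<subseteq> A \<union> B"
    if "l \<in> \<Lambda>P" "r \<in> UP l" "s \<in> UP l" "r \<noteq> s" "cbar r = v" "cbar s = v" for l r s v
    using Reeb_proper_fibre_separation[OF HX cc _ prP[OF that(1)], of r s v] that oP
    by (simp add: R_def cbar_def)
  have VW: "V \<subseteq> W" by (auto simp: W_def V_def)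
  have WR: "W \<subseteq> topspace R" by (auto simp: W_def)
  have cover: "r \<in> V \<or> (\<exists>l\<in>\<Lambda>P. r \<in> UP l) \<or> (\<exists>l\<in>\<Lambda>NP. r \<in> UNP l)" if "r \<in> topspace R" for r
    using that by (auto simp: V_def)
  have part1: "Hausdorff_space R \<longleftrightarrow>
            (\<forall>v \<in> cbar ` V. \<forall>r\<in>topspace R. \<forall>s\<in>topspace R.
               cbar r = v \<and> cbar s = v \<and> r \<noteq> s \<longrightarrow>
               (\<exists>A B. openin R A \<and> openin R B \<and> r \<in> A \<and> s \<in> B \<and> A \<inter> B = {}))" (is "_ \<longleftrightarrow> ?sep")
  proof
    assume "Hausdorff_space R"
    then show ?sep unfolding Hausdorff_space_def disjnt_def by blast
  next
    assume sep: ?sep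
    show "Hausdorff_space R"
      unfolding Hausdorff_space_def
    proof (intro allI impI, elim conjE)
      fix r s assume r: "r \<in> topspace R" and s: "s \<in> topspace R" and rs: "r \<noteq> s"
      have "\<exists>A B. openin R A \<and> openin R B \<and> r \<in> A \<and> s \<in> B \<and> A \<inter> B = {}"
      proof (cases "cbar r = cbar s")
        case False
        then obtain A B where AB: "open A" "open B" "cbar r \<in> A" "cbar s \<in> B" "A \<inter> B = {}"
          using hausdorff by metis
        have "openin R {u \<in> topspace R. cbar u \<in> A}" "openin R {u \<in> topspace R. cbar u \<in> B}"
          using AB by (auto intro!: openin_continuous_map_preimage[OF cbar])
        moreover have "{u \<in> topspace R. cbar u \<in> A} \<inter> {u \<in> topspace R. cbar u \<in> B} = {}"
          using AB(5) by auto
        ultimately show ?thesis using AB(3,4) r s by blast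
      next
        case eq: True
        show ?thesis
        proof (cases "cbar r \<in> cbar ` V")
          case True
          then show ?thesis using sep[rule_format, OF True r s] rs eq by metis
        next
          case False
          then have "r \<notin> V" "s \<notin> V" using imageI[of r V cbar] imageI[of s V cbar] eq by auto
          then consider l where "l \<in> \<Lambda>P" "r \<in> UP l" "s \<in> UP l"
            | l where "l \<in> \<Lambda>P" "r \<in> UP l" "s \<notin> UP l"
            | l where "l \<in> \<Lambda>NP" "r \<in> UNP l" "s \<in> UNP l"
            | l m where "l \<in> \<Lambda>NP" "r \<in> UNP l" "m \<in> \<Lambda>NP" "s \<in> UNP m" "l \<noteq> m"
            | l m where "l \<in> \<Lambda>NP" "r \<in> UNP l" "m \<in> \<Lambda>P" "s \<in> UP m"
            using cover[OF r] cover[OF s] by metis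
          then show ?thesis
          proof cases
            case (1 l)
            then show ?thesis using sepP[OF 1 rs refl] eq by metis
          next
            case (2 l)
            then show ?thesis
              using oP[OF 2(1)] openin_diff[OF openin_topspace clP[OF 2(1)]] s
              by (intro exI[of _ "UP l"] exI[of _ "topspace R - UP l"]) auto
          next
            case (3 l)
            then show ?thesis using inj_onD[OF injN[OF 3(1)] eq] rs by blast
          next
            case (4 l m)
            then have "UNP l \<inter> UNP m = {}" using disj_NP by (auto simp: disjoint_family_on_def)
            then show ?thesis using 4 oN by blast
          next
            case (5 l m)
            then show ?thesis using oN oP disj_P_NP[OF 5(3,1)] by blast
          qed
        qed
      qed
      then show "\<exists>A B. openin R A \<and> openin R B \<and> r \<in> A \<and> s \<in> B \<and> disjnt A B"
        by (simp add: disjnt_def)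
    qed
  qed
  define Z where "Z = W \<union> q ` S"
  have part2: "(\<exists>\<E>. CW_complex_1 R Z \<E> \<and> closed_discrete_in R Z) \<longleftrightarrow>
      closed_discrete_in R W \<and> (\<forall>l\<in>\<Lambda>P. finite (c ` (S \<inter> \<Union>(UP l))))"
    if HR: "Hausdorff_space R" and cpt: "\<forall>l\<in>\<Lambda>P. compactin R (R closure_of UP l)"
  proof -
    have cP: "compactin R (UP l)" if "l \<in> \<Lambda>P" for l
      using cpt clP[OF that] closure_of_closedin that by metis
    have crit_image: "c ` (S \<inter> \<Union>(UP l)) = cbar ` (q ` S \<inter> UP l)" if l: "l \<in> \<Lambda>P" for l
    proof (intro set_eqI iffI)
      fix t assume "t \<in> c ` (S \<inter> \<Union>(UP l))"
      then obtain x r where x: "x \<in> S" "x \<in> r" "r \<in> UP l" "t = c x" by auto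
      then have "q x = r" "cbar r = c x" using mem[of r x] PR[OF l] by auto
      then show "t \<in> cbar ` (q ` S \<inter> UP l)" using x by (intro image_eqI[of _ _ r]) auto
    next
      fix t assume "t \<in> cbar ` (q ` S \<inter> UP l)"
      then obtain r where r: "r \<in> q ` S" "r \<in> UP l" "t = cbar r" by auto
      then obtain x where "x \<in> r" "x \<in> S" using qS(3) by blast
      then show "t \<in> c ` (S \<inter> \<Union>(UP l))"
        using r mem(3)[of r x] PR[OF l] by (intro image_eqI[of _ _ x]) auto
    qed
    show ?thesis
    proof
      assume "\<exists>\<E>. CW_complex_1 R Z \<E> \<and> closed_discrete_in R Z"
      then have Z: "closed_discrete_in R Z" by auto
      have "finite (c ` (S \<inter> \<Union>(UP l)))" if l: "l \<in> \<Lambda>P" for l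
      proof -
        have "finite (UP l \<inter> Z)" using Z cP[OF l] by (rule closed_discrete_Int_compact_finite)
        then have "finite (q ` S \<inter> UP l)" by (rule finite_subset[rotated]) (auto simp: Z_def)
        then show ?thesis by (simp add: crit_image[OF l])
      qed
      moreover have "closed_discrete_in R W"
        using Z by (rule closed_discrete_in_subset) (auto simp: Z_def)
      ultimately show "closed_discrete_in R W \<and> (\<forall>l\<in>\<Lambda>P. finite (c ` (S \<inter> \<Union>(UP l))))" by auto
    next
      assume asm: "closed_discrete_in R W \<and> (\<forall>l\<in>\<Lambda>P. finite (c ` (S \<inter> \<Union>(UP l))))"
      then have W: "closed_discrete_in R W" by auto
      have finP: "finite (UP l \<inter> Z)" if l: "l \<in> \<Lambda>P" for l
      proof -
        let ?D = "c ` (S \<inter> \<Union>(UP l))"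
        have D: "finite ?D" using asm l by auto
        have "finite {u \<in> UP l. cbar u = v}" for v
        proof (rule finite_fibre[OF HR lcR cbar cP[OF l] oP[OF l] D])
          show "regular_at R cbar r" if r: "r \<in> UP l" "cbar r \<notin> ?D" for r
          proof (rule regP[OF l r(1)])
            show "r \<inter> S = {}"
            proof (rule ccontr)
              assume "r \<inter> S \<noteq> {}"
              then have "r \<in> q ` S" using qS(2) r(1) PR[OF l] by blast
              then show False using r unfolding crit_image[OF l] by auto
            qed
          qed
        qed (rule sepP[OF l])
        then have "finite (\<Union>v\<in>?D. {u \<in> UP l. cbar u = v})" by (rule finite_UN_I[OF D])
        moreover have "q ` S \<inter> UP l \<subseteq> (\<Union>v\<in>?D. {u \<in> UP l. cbar u = v})"
          unfolding crit_image[OF l] by auto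
        ultimately have "finite (q ` S \<inter> UP l)" by (rule finite_subset[rotated])
        moreover have "finite (UP l \<inter> W)" using W cP[OF l] by (rule closed_discrete_Int_compact_finite)
        moreover have "UP l \<inter> Z = (q ` S \<inter> UP l) \<union> (UP l \<inter> W)" by (auto simp: Z_def)
        ultimately show ?thesis by simp
      qed
      have noN: "q ` S \<inter> UNP l = {}" if "l \<in> \<Lambda>NP" for l
        using critN[OF that] qS(3) by blast
      have ZR: "Z \<subseteq> topspace R" using WR qS(1) by (auto simp: Z_def)
      have Zcd: "closed_discrete_in R Z"
      proof (rule closed_discrete_inI[OF ZR])
        fix x assume x: "x \<in> topspace R"
        consider "x \<in> V" | l where "l \<in> \<Lambda>P" "x \<in> UP l" | l where "l \<in> \<Lambda>NP" "x \<in> UNP l"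
          using cover[OF x] by blast
        then show "\<exists>U. openin R U \<and> x \<in> U \<and> U \<inter> Z \<subseteq> {x}"
        proof cases
          case 1
          \<comment> \<open>A connected neighbourhood of a point of \<open>V\<close> misses all proper pieces, as they are open and closed; so infinitely many of them cannot accumulate there.\<close>
          obtain U where U: "openin R U" "connectedin R U" "x \<in> U" "U \<inter> W \<subseteq> {x}"
            by (rule closed_discrete_isolating[OF lcR W openin_topspace x])
          have noP: "U \<inter> UP l = {}" if l: "l \<in> \<Lambda>P" for l
          proof (rule ccontr)
            assume "U \<inter> UP l \<noteq> {}"
            moreover have "x \<notin> UP l" using 1 l by (auto simp: V_def)
            ultimately show False
              using connectedinD[OF U(2) oP[OF l] openin_diff[OF openin_topspace clP[OF l]]]
                U(3) x openin_subset[OF U(1)] by blast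
          qed
          have "y \<in> V" if y: "y \<in> U" "y \<in> q ` S" for y
          proof -
            have "y \<in> topspace R" using y qS(1) by auto
            moreover have "\<not> (\<exists>l\<in>\<Lambda>P. y \<in> UP l)" using noP y(1) by auto
            moreover have "\<not> (\<exists>l\<in>\<Lambda>NP. y \<in> UNP l)" using noN y(2) by auto
            ultimately show ?thesis using cover[of y] by simp
          qed
          then have "U \<inter> Z \<subseteq> {x}" using U(4) VW by (auto simp: Z_def)
          then show ?thesis using U by blast
        next
          case (2 l)
          have "closedin R (UP l \<inter> Z - {x})"
            using finP[OF 2(1)] HR PR[OF 2(1)] by (intro closedin_Hausdorff_finite) auto
          then have "openin R (UP l - (UP l \<inter> Z - {x}))" using oP[OF 2(1)] by (intro openin_diff)
          then show ?thesis using 2 by (intro exI[of _ "UP l - (UP l \<inter> Z - {x})"]) auto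
        next
          case (3 l)
          obtain U where U: "openin R U" "connectedin R U" "x \<in> U" "U \<inter> W \<subseteq> {x}" "U \<subseteq> UNP l"
            by (rule closed_discrete_isolating[OF lcR W oN[OF 3(1)] 3(2)])
          then have "U \<inter> Z \<subseteq> {x}" using noN[OF 3(1)] by (auto simp: Z_def)
          then show ?thesis using U by blast
        qed
      qed
      have "CW_complex_1 R Z (connected_components_of (subtopology R (topspace R - Z)))"
      proof (rule regular_off_discrete_imp_CW[OF HR lcR cbar Zcd])
        fix x assume x: "x \<in> topspace R - Z"
        then have "x \<notin> V" "x \<inter> S = {}" using VW qS(2) by (auto simp: Z_def)
        then show "regular_at R cbar x" using cover x regP regN by blast
      qed
      then show "\<exists>\<E>. CW_complex_1 R Z \<E> \<and> closed_discrete_in R Z" using Zcd by blast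
    qed
  qed
  have cells: "(\<exists>Z' \<E>. CW_complex_1 R Z' \<E> \<and> Z' = Z \<and> closed_discrete_in R Z) \<longleftrightarrow>
      (\<exists>\<E>. CW_complex_1 R Z \<E> \<and> closed_discrete_in R Z)"
    by blast
  have crit_vals: "(\<forall>l\<in>\<Lambda>P. finite (c ` critical_set n (restrict_atlas \<A> (pre (UP l))) c)) \<longleftrightarrow>
      (\<forall>l\<in>\<Lambda>P. finite (c ` (S \<inter> \<Union>(UP l))))"
    by (rule ball_cong[OF refl]) (simp only: critP)
  show ?thesis
    unfolding S_def[symmetric] Z_def[symmetric] cells crit_vals
    by (intro conjI impI part1) (elim conjE, rule part2)
qed

end
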